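(* Let $G$ be a set of positive integers. There exists a set of integers $R=\{r_1,r_2,\ldots\}$ such that, for every positive integer $k$, the set $R^k=\{r_1^k,r_2^k,\ldots\}$ is intersective if and only if $k\in G$.
   Context: The upper density of a set of integers $\Lambda$ is $\bar d(\Lambda)=\limsup_{N\to\infty}|\Lambda\cap\{-N,\ldots,N\}|/(2N+1)$; $\Lambda$ has positive upper density if $\bar d(\Lambda)>0$. A set of integers $R$ is called intersective if for every set of integers $\Lambda$ with positive upper density, the equation $x-y=r$ is solvable in $x,y\in\Lambda$ and $r\in R\setminus\{0\}$; equivalently, $\Lambda\cap(\Lambda-r)\neq\emptyset$ for some nonzero $r\in R$. *)

theory Defs
  imports Complex_Main "HOL-Library.Extended_Real"
begin

text \<open>The limit superior is taken in \<^typ>\<open>ereal\<close>, a complete lattice; the quotients all lie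
  between 0 and 1.\<close>

definition upper_density :: "int set \<Rightarrow> ereal" where
  "upper_density \<Lambda> =
     limsup (\<lambda>N::nat. ereal (real (card (\<Lambda> \<inter> {- int N..int N})) / (2 * real N + 1)))"

definition intersective :: "int set \<Rightarrow> bool" where
  "intersective R \<longleftrightarrow>
     (\<forall>\<Lambda>::int set. upper_density \<Lambda> > 0 \<longrightarrow>
        (\<exists>x\<in>\<Lambda>. \<exists>y\<in>\<Lambda>. \<exists>r\<in>R - {0}. x - y = r))"

end

theory Submission
  imports Defs "HOL-Probability.Probability"
begin

text \<open>Fix an irrational \<open>\<alpha>\<close>. Excluding \<open>r\<close> with \<open>\<alpha> r\<^sup>l\<close> close to an integer (depending on
  \<open>l\<close> only) makes \<open>R\<^sup>l\<close> avoid the differences of a Bohr set, so that \<open>R\<^sup>l\<close> is not intersective.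
  Imposing this for finitely many \<open>l \<noteq> k\<close> at a time does not destroy recurrence along \<open>r\<^sup>k\<close>:
  in the average of \<open>e (m \<alpha> r\<^sup>l + \<theta> r\<^sup>k)\<close> the exponents differ, so for irrational \<open>\<theta>\<close> the phases
  cannot cancel, and Weyl's theorem together with a spectral measure having an atom at 0
  (as in Kamae and Mendes France) gives a return time. A weak limit of spectral measures yields a
  bound for \<open>r\<close> in terms of the density alone. Hence \<open>R\<close> can be the union of finite sets, the
  \<open>n\<close>-th one obeying the restrictions for \<open>l \<le> n\<close> and serving densities above \<open>1 / (n + 1)\<close>;
  each restriction fails at finitely many elements of \<open>R\<close>, which a congruence condition removes.\<close>

section \<open>Weyl equidistribution by van der Corput differencing\<close>

definition ee :: "real \<Rightarrow> complex" where
  "ee t = cis (2 * pi * t)"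

lemma ee_add: "ee (s + t) = ee s * ee t"
  by (simp add: ee_def cis_mult distrib_left)

lemma ee_0 [simp]: "ee 0 = 1"
  by (simp add: ee_def)

lemma norm_ee [simp]: "norm (ee t) = 1"
  by (simp add: ee_def)

lemma cnj_ee: "cnj (ee t) = ee (- t)"
  by (simp add: ee_def cis_cnj)

lemma ee_mult_cnj: "ee s * cnj (ee t) = ee (s - t)"
  by (simp add: cnj_ee ee_add [symmetric])

lemma ee_eq_1_iff: "ee t = 1 \<longleftrightarrow> t \<in> \<int>"
proof
  assume "ee t = 1"
  then have "cos (2 * pi * t) = 1"
    by (simp add: ee_def complex_eq_iff)
  then obtain n :: int where "2 * pi * t = of_int n * 2 * pi"
    using cos_one_2pi_int by auto
  then show "t \<in> \<int>" by simp
next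
  assume "t \<in> \<int>"
  then obtain n where "t = of_int n" by (elim Ints_cases)
  then show "ee t = 1"
    using cis_multiple_2pi [of "of_int n"] by (simp add: ee_def)
qed

lemma ee_power: "ee t ^ n = ee (real n * t)"
  by (induction n) (auto simp: distrib_right ee_add)

lemma continuous_on_ee [continuous_intros]:
  "continuous_on A f \<Longrightarrow> continuous_on A (\<lambda>x. ee (f x))"
  unfolding ee_def cis_conv_exp by (intro continuous_intros)

lemma borel_measurable_ee [measurable]: "ee \<in> borel_measurable borel"
  by (intro borel_measurable_continuous_onI continuous_intros)

section \<open>Cesaro averages and van der Corput's method\<close>

definition avg :: "(nat \<Rightarrow> complex) \<Rightarrow> nat \<Rightarrow> complex" where
  "avg u n = (\<Sum>s<n. u s) / of_nat n"

lemma norm_avg_le: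
  assumes "\<And>s. norm (u s) \<le> C" and "0 \<le> C"
  shows "norm (avg u n) \<le> C"
proof (cases "n = 0")
  case False
  have "norm (\<Sum>s<n. u s) \<le> (\<Sum>s<n. C)"
    by (intro sum_norm_le) (use assms in auto)
  then show ?thesis
    using False by (simp add: avg_def norm_divide field_simps)
qed (use assms in \<open>auto simp: avg_def\<close>)

text \<open>By telescoping, the two sums differ only in the end terms \<open>u n\<close> and
  \<open>u 0\<close>, a bounded quantity divided by \<open>n\<close>.\<close>

lemma avg_Suc_diff:
  assumes "\<And>s. norm (u s) \<le> C"
  shows "(\<lambda>n. avg (\<lambda>s. u (Suc s)) n - avg u n) \<longlonglongrightarrow> 0"
proof (rule Lim_null_comparison)
  have "avg (\<lambda>s. u (Suc s)) n - avg u n = (u n - u 0) / of_nat n" for n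
    by (simp add: avg_def diff_divide_distrib [symmetric] sum_subtractf [symmetric] sum_lessThan_telescope)
  moreover have "norm (u n - u 0) \<le> C + C" for n
    by (rule order_trans [OF norm_triangle_ineq4 add_mono [OF assms assms]])
  ultimately show "\<forall>\<^sub>F n in sequentially. norm (avg (\<lambda>s. u (Suc s)) n - avg u n) \<le> (C + C) / real n"
    by (auto simp: norm_divide intro!: divide_right_mono always_eventually)
qed real_asymp

lemma avg_shift_diff:
  assumes "\<And>s. norm (u s) \<le> C"
  shows "(\<lambda>n. avg (\<lambda>s. u (s + h)) n - avg u n) \<longlonglongrightarrow> 0"
proof (induction h)
  case (Suc h)
  have "(\<lambda>n. avg (\<lambda>s. u (Suc s + h)) n - avg (\<lambda>s. u (s + h)) n) \<longlonglongrightarrow> 0"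
    by (rule avg_Suc_diff [where C = C]) (rule assms)
  from tendsto_add [OF this Suc] show ?case by simp
qed simp

lemma tendsto_avg_Suc:
  assumes "\<And>s. norm (u s) \<le> C" and "avg u \<longlonglongrightarrow> l"
  shows "avg (\<lambda>s. u (Suc s)) \<longlonglongrightarrow> l"
  using tendsto_add [OF avg_Suc_diff [of u, OF assms(1)] assms(2)] by simp

text \<open>The average of \<open>u\<close> is asymptotically that of the mean of \<open>H\<close>
  shifts. Cauchy-Schwarz bounds the square of the latter by the mean of \<open>H^2\<close> pair
  correlations, of which only the \<open>H\<close> diagonal ones survive, leaving
  \<open>1 / H\<close>; and \<open>H\<close> is arbitrary.\<close>

lemma van_der_Corput:
  assumes norm1: "\<And>s. norm (u s) = 1"
    and corr: "\<And>h h'. h \<noteq> h' \<Longrightarrow> avg (\<lambda>s. u (s + h) * cnj (u (s + h'))) \<longlonglongrightarrow> 0"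
  shows "avg u \<longlonglongrightarrow> 0"
proof (rule tendstoI)
  fix e :: real
  assume "e > 0"
  \<comment> \<open>Any \<open>H > 4 / e^2\<close> gives \<open>1 / H < (e / 2)^2\<close>; the other
    half of \<open>e\<close> is spent on replacing \<open>avg u\<close> by the shifted mean
    \<open>E\<close>.\<close>
  define H where "H = nat \<lceil>8 / e\<^sup>2\<rceil> + 1"
  have "real H > 8 / e\<^sup>2" "H > 0"
    unfolding H_def by linarith+
  then have H: "1 / real H < (e / 2)\<^sup>2"
    using \<open>e > 0\<close> by (simp add: field_simps)
  define E where "E n = (\<Sum>h<H. avg (\<lambda>s. u (s + h)) n) / of_nat H" for n
  define X where
    "X n = (\<Sum>h<H. \<Sum>h'<H. avg (\<lambda>s. u (s + h) * cnj (u (s + h'))) n) / (of_nat H)\<^sup>2" for n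
  have diag: "avg (\<lambda>s. u (s + h) * cnj (u (s + h))) \<longlonglongrightarrow> 1" for h
  proof (rule tendsto_eventually)
    have "avg (\<lambda>s. u (s + h) * cnj (u (s + h))) n = 1" if "n > 0" for n
      using that by (simp add: avg_def complex_norm_square [symmetric] norm1)
    then show "\<forall>\<^sub>F n in sequentially. avg (\<lambda>s. u (s + h) * cnj (u (s + h))) n = 1"
      using eventually_gt_at_top [of 0] by (rule eventually_mono[rotated])
  qed
  have "X \<longlonglongrightarrow> (\<Sum>h<H. \<Sum>h'<H. if h = h' then 1 else 0) / (of_nat H)\<^sup>2"
    unfolding X_def using diag corr \<open>H > 0\<close> by (intro tendsto_intros) auto
  moreover have "(\<Sum>h<H. \<Sum>h'<H. if h = h' then 1 else 0) / (of_nat H)\<^sup>2 = (1 / of_nat H :: complex)"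
    using \<open>H > 0\<close> by (simp add: power2_eq_square)
  ultimately have "(\<lambda>n. norm (X n)) \<longlonglongrightarrow> norm (1 / of_nat H :: complex)"
    by (metis tendsto_norm)
  then have "(\<lambda>n. norm (X n)) \<longlonglongrightarrow> 1 / real H"
    by (simp add: norm_divide)
  then have ev1: "\<forall>\<^sub>F n in sequentially. norm (X n) < (e / 2)\<^sup>2"
    using H order_tendstoD(2) by blast
  \<comment> \<open>Summing over \<open>h\<close> first turns the numerator of \<open>X n\<close>
    into the sum of the squares of the block sums \<open>b s\<close>, to which Cauchy-Schwarz in
    \<open>s\<close> applies.\<close>
  have EX: "(norm (E n))\<^sup>2 \<le> norm (X n)" if "n > 0" for n
  proof -
    define b where "b s = (\<Sum>h<H. u (s + h))" for s
    have E: "E n = (\<Sum>s<n. b s) / (of_nat n * of_nat H)"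
      unfolding E_def avg_def b_def sum_divide_distrib [symmetric]
      by (subst sum.swap) simp
    have "X n = (\<Sum>h<H. \<Sum>h'<H. \<Sum>s<n. u (s + h) * cnj (u (s + h'))) / (of_nat n * (of_nat H)\<^sup>2)"
      unfolding X_def avg_def by (simp add: sum_divide_distrib [symmetric])
    also have "(\<Sum>h<H. \<Sum>h'<H. \<Sum>s<n. u (s + h) * cnj (u (s + h')))
        = (\<Sum>h<H. \<Sum>s<n. \<Sum>h'<H. u (s + h) * cnj (u (s + h')))"
      by (intro sum.cong refl sum.swap)
    also have "\<dots> = (\<Sum>s<n. b s * cnj (b s))"
      unfolding b_def cnj_sum sum_product
      by (rule sum.swap)
    also have "\<dots> = of_real (\<Sum>s<n. (norm (b s))\<^sup>2)"
      by (simp add: complex_norm_square [symmetric] del: of_real_power)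
    finally have X: "norm (X n) = (\<Sum>s<n. (norm (b s))\<^sup>2) / (real n * (real H)\<^sup>2)"
      by (simp add: norm_divide norm_mult norm_power sum_nonneg del: of_real_sum)
    have "(norm (\<Sum>s<n. b s))\<^sup>2 \<le> (\<Sum>s<n. norm (b s))\<^sup>2"
      by (intro power_mono norm_sum) auto
    also have "\<dots> \<le> (\<Sum>s<n. (norm (b s))\<^sup>2) * real n"
      using sum_squared_le_sum_of_squares [of "\<lambda>s. norm (b s)" "{..<n}"] by simp
    finally have "(norm (\<Sum>s<n. b s))\<^sup>2 / (real n * real H)\<^sup>2
        \<le> ((\<Sum>s<n. (norm (b s))\<^sup>2) * real n) / (real n * real H)\<^sup>2"
      by (rule divide_right_mono) simp
    also have "\<dots> = norm (X n)"
      unfolding X using that by (simp add: power2_eq_square)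
    finally show ?thesis
      unfolding E by (simp add: norm_divide norm_mult power_divide)
  qed
  have "(\<lambda>n. (\<Sum>h<H. avg (\<lambda>s. u (s + h)) n - avg u n) / of_nat H) \<longlonglongrightarrow> (\<Sum>h<H. 0) / of_nat H"
    using \<open>H > 0\<close> by (intro tendsto_intros avg_shift_diff [where C = 1]) (auto simp: norm1)
  moreover have "(\<Sum>h<H. avg (\<lambda>s. u (s + h)) n - avg u n) / of_nat H = E n - avg u n" for n
    using \<open>H > 0\<close> by (simp add: E_def sum_subtractf diff_divide_distrib)
  ultimately have "(\<lambda>n. E n - avg u n) \<longlonglongrightarrow> 0" by simp
  then have ev2: "\<forall>\<^sub>F n in sequentially. norm (E n - avg u n) < e / 2"
    using \<open>e > 0\<close> by (auto dest!: tendstoD [where e = "e / 2"] simp: dist_norm)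
  show "\<forall>\<^sub>F n in sequentially. dist (avg u n) 0 < e"
    using ev1 ev2 eventually_gt_at_top [of 0]
  proof eventually_elim
    case (elim n)
    then have "(norm (E n))\<^sup>2 < (e / 2)\<^sup>2"
      using EX [of n] by linarith
    then have "norm (E n) < e / 2"
      using \<open>e > 0\<close> by (intro power2_less_imp_less [where y = "e / 2"]) auto
    then show ?case
      using elim(2) norm_triangle_ineq4 [of "E n" "E n - avg u n"] by (simp add: dist_norm)
  qed
qed

section \<open>Weyl sums of polynomials\<close>

lemma avg_ee_linear:
  assumes "c \<notin> \<int>"
  shows "avg (\<lambda>s. ee (c * real s + b)) \<longlonglongrightarrow> 0"
proof (rule Lim_null_comparison)
  have ne: "ee c \<noteq> 1" using assms by (simp add: ee_eq_1_iff)
  show "\<forall>\<^sub>F n in sequentially. norm (avg (\<lambda>s. ee (c * real s + b)) n) \<le> (2 / norm (ee c - 1)) / real n"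
  proof (rule always_eventually, rule allI)
    fix n
    have "(\<Sum>s<n. ee (c * real s + b)) = (\<Sum>s<n. ee c ^ s) * ee b"
      by (simp add: ee_add ee_power sum_distrib_right mult.commute [of c])
    also have "(\<Sum>s<n. ee c ^ s) = (ee c ^ n - 1) / (ee c - 1)"
      using ne by (rule geometric_sum)
    finally have "norm (\<Sum>s<n. ee (c * real s + b)) = norm (ee c ^ n - 1) / norm (ee c - 1)"
      by (simp add: norm_mult norm_divide)
    \<comment> \<open>This bound on the geometric sum does not depend on \<open>n\<close>, so
      division by \<open>n\<close> sends the average to 0.\<close>
    also have "\<dots> \<le> 2 / norm (ee c - 1)"
      using norm_triangle_ineq4 [of "ee c ^ n" 1]
      by (intro divide_right_mono) (auto simp: norm_power)
    finally show "norm (avg (\<lambda>s. ee (c * real s + b)) n) \<le> (2 / norm (ee c - 1)) / real n"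
      unfolding avg_def norm_divide norm_of_nat by (intro divide_right_mono) auto
  qed
qed real_asymp

text \<open>A polynomial of degree at most \<open>d\<close> whose coefficient at degree \<open>d\<close> is \<open>c / d!\<close>;
  in this normalisation differencing multiplies the leading term by \<open>h - h'\<close> only.\<close>

primrec polylead :: "nat \<Rightarrow> real \<Rightarrow> (nat \<Rightarrow> real) \<Rightarrow> bool" where
  "polylead 0 c f \<longleftrightarrow> (\<forall>s. f s = c)"
| "polylead (Suc d) c f \<longleftrightarrow>
     (\<forall>h h'. polylead d ((real h - real h') * c) (\<lambda>s. f (s + h) - f (s + h')))"

lemma polylead_add:
  "polylead d a f \<Longrightarrow> polylead d b g \<Longrightarrow> polylead d (a + b) (\<lambda>s. f s + g s)"
proof (induction d arbitrary: a b f g)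
  case (Suc d)
  show ?case
  proof (simp, intro allI)
    fix h h'
    have "polylead d ((real h - real h') * a) (\<lambda>s. f (s + h) - f (s + h'))"
      "polylead d ((real h - real h') * b) (\<lambda>s. g (s + h) - g (s + h'))"
      using Suc.prems by auto
    from Suc.IH [OF this]
    show "polylead d ((real h - real h') * (a + b)) (\<lambda>s. f (s + h) + g (s + h) - (f (s + h') + g (s + h')))"
      by (simp add: algebra_simps)
  qed
qed simp

lemma polylead_cmult: "polylead d a f \<Longrightarrow> polylead d (b * a) (\<lambda>s. b * f s)"
proof (induction d arbitrary: a f)
  case (Suc d)
  show ?case
  proof (simp, intro allI)
    fix h h'
    have "polylead d ((real h - real h') * a) (\<lambda>s. f (s + h) - f (s + h'))"
      using Suc.prems by auto
    from Suc.IH [OF this]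
    show "polylead d ((real h - real h') * (b * a)) (\<lambda>s. b * f (s + h) - b * f (s + h'))"
      by (simp add: algebra_simps)
  qed
qed simp

lemma polylead_sum:
  assumes "finite I" and "\<And>i. i \<in> I \<Longrightarrow> polylead d (a i) (f i)"
  shows "polylead d (\<Sum>i\<in>I. a i) (\<lambda>s. \<Sum>i\<in>I. f i s)"
  using assms
proof (induction I rule: finite_induct)
  case empty
  have "polylead d 0 (\<lambda>s. 0)" for d by (induction d) auto
  then show ?case by simp
qed (auto intro: polylead_add)

text \<open>Powers with \<open>j < d\<close> are included, with leading coefficient 0, so that
  lower-order terms can be added. Differencing \<open>s ^ j\<close> gives the top coefficient
  \<open>j * (h - h')\<close>, and the factor \<open>j\<close> completes the factorial.\<close>

lemma polylead_power:
  "j \<le> d \<Longrightarrow> polylead d (if j = d then fact d else 0) (\<lambda>s. real s ^ j)"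
proof (induction d arbitrary: j)
  case (Suc d)
  show ?case
  proof (simp only: polylead.simps, intro allI)
    fix h h' :: nat
    define b where "b i = real (j choose i) * (real h ^ (j - i) - real h' ^ (j - i))" for i
    have expand: "real (s + h) ^ j - real (s + h') ^ j = (\<Sum>i<j. b i * real s ^ i)" for s
    proof -
      have "real (s + h) ^ j - real (s + h') ^ j = (\<Sum>i\<le>j. b i * real s ^ i)"
        unfolding of_nat_add binomial_ring [of "real s"] b_def sum_subtractf [symmetric]
        by (simp add: algebra_simps)
      \<comment> \<open>The term \<open>i = j\<close> drops out because
        \<open>h ^ 0 - h' ^ 0 = 0\<close>; this is what lowers the degree.\<close>
      also have "\<dots> = (\<Sum>i<j. b i * real s ^ i)"
        by (simp add: lessThan_Suc_atMost [symmetric] b_def)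
      finally show ?thesis .
    qed
    have "polylead d (\<Sum>i<j. b i * (if i = d then fact d else 0)) (\<lambda>s. \<Sum>i<j. b i * real s ^ i)"
      using Suc by (intro polylead_sum polylead_cmult) auto
    also have "(\<Sum>i<j. b i * (if i = d then fact d else 0)) = (\<Sum>i<j. if i = d then b d * fact d else 0)"
      by (intro sum.cong) auto
    also have "\<dots> = (if j = Suc d then b d * fact d else 0)"
      using Suc.prems by auto
    also have "\<dots> = (real h - real h') * (if j = Suc d then fact (Suc d) else 0)"
      by (auto simp: b_def)
    finally show "polylead d ((real h - real h') * (if j = Suc d then fact (Suc d) else 0))
        (\<lambda>s. real (s + h) ^ j - real (s + h') ^ j)"
      by (simp only: expand)
  qed
qed simp

lemma of_int_mult_irrational:
  assumes "x \<notin> \<rat>" and "n \<noteq> 0"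
  shows "real_of_int n * x \<notin> \<rat>"
proof
  assume "real_of_int n * x \<in> \<rat>"
  then have "real_of_int n * x / real_of_int n \<in> \<rat>"
    by (intro Rats_divide Rats_of_int)
  then show False using assms by simp
qed

text \<open>Induction on the degree: a correlation of the phase with shifts
  \<open>h \<noteq> h'\<close> is a polynomial phase of one degree less, whose leading datum
  \<open>(h - h') * c\<close> is still irrational, so van der Corput's criterion applies. The linear
  case is a geometric sum.\<close>

lemma weyl:
  assumes "polylead (Suc d) c f" and "c \<notin> \<rat>"
  shows "avg (\<lambda>s. ee (f s)) \<longlonglongrightarrow> 0"
  using assms
proof (induction d arbitrary: c f)
  case 0
  have "f (0 + s) - f (0 + 0) = (real s - real 0) * c" for s
    using 0(1) unfolding polylead.simps by blast
  then have f: "f s = c * real s + f 0" for s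
    by (metis (no_types) add_0 diff_add_cancel diff_zero mult.commute of_nat_0)
  have "c \<notin> \<int>" using 0 Ints_subset_Rats by blast
  then have "avg (\<lambda>s. ee (c * real s + f 0)) \<longlonglongrightarrow> 0"
    by (rule avg_ee_linear)
  then show ?case
    by (simp only: f [symmetric])
next
  case (Suc d)
  show ?case
  proof (rule van_der_Corput)
    fix h h' :: nat
    assume "h \<noteq> h'"
    then have "real_of_int (int h - int h') * c \<notin> \<rat>"
      using Suc.prems by (intro of_int_mult_irrational) auto
    moreover have "polylead (Suc d) ((real h - real h') * c) (\<lambda>s. f (s + h) - f (s + h'))"
      using Suc.prems(1) by (subst (asm) polylead.simps) blast
    ultimately have "avg (\<lambda>s. ee (f (s + h) - f (s + h'))) \<longlonglongrightarrow> 0"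
      by (intro Suc.IH) auto
    then show "avg (\<lambda>s. ee (f (s + h)) * cnj (ee (f (s + h')))) \<longlonglongrightarrow> 0"
      by (simp add: ee_mult_cnj)
  qed simp
qed

lemma weyl_two_terms:
  assumes "j < d" and "a \<notin> \<rat>"
  shows "avg (\<lambda>s. ee (a * real s ^ d + b * real s ^ j)) \<longlonglongrightarrow> 0"
proof -
  \<comment> \<open>The trivial test \<open>d = d\<close> lets \<open>polylead_power\<close> match
    both summands.\<close>
  have "polylead d (a * (if d = d then fact d else 0) + b * (if j = d then fact d else 0))
      (\<lambda>s. a * real s ^ d + b * real s ^ j)"
    using assms(1) by (intro polylead_add polylead_cmult polylead_power) auto
  then have "polylead (Suc (d - 1)) (fact d * a) (\<lambda>s. a * real s ^ d + b * real s ^ j)"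
    using assms(1) by (simp add: mult.commute)
  moreover have "fact d * a \<notin> \<rat>"
    using of_int_mult_irrational [OF assms(2), of "fact d"] by simp
  ultimately show ?thesis by (rule weyl)
qed


section \<open>Spectral measures of sets of integers\<close>

text \<open>Dividing by \<open>card B\<close> rather than by the length of a window gives
  \<open>corr B 0 = 1\<close> for finite nonempty \<open>B\<close>, so that the spectral measure has
  total mass 1.\<close>

definition corr :: "int set \<Rightarrow> int \<Rightarrow> real" where
  "corr B h = real (card {x \<in> B. x + h \<in> B}) / real (card B)"

lemma corr_nonneg: "0 \<le> corr B h"
  by (simp add: corr_def)

text \<open>Let \<open>g x\<close> count the \<open>h < H\<close> with \<open>x + h\<close> in
  \<open>B\<close>. Its sum over a window is \<open>H * card B\<close>, the sum of its squares is
  \<open>card B\<close> times the right-hand side, and Cauchy-Schwarz compares the two.\<close>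

lemma corr_sum_ge:
  fixes N :: int
  assumes B: "B \<subseteq> {-N..N}" "B \<noteq> {}"
  shows "real H ^ 2 * real (card B) / (2 * real_of_int N + 1 + real H)
    \<le> (\<Sum>h<H. \<Sum>h'<H. corr B (int h - int h'))"
proof -
  have fin: "finite B" using B(1) by (rule finite_subset) simp
  have "N \<ge> 0" using B by fastforce
  \<comment> \<open>The window contains the support of \<open>g\<close>: shifts by less than
    \<open>H\<close> enlarge \<open>{-N..N}\<close> to the left only.\<close>
  define I where "I = {- N - int H..N}"
  have cardI: "real (card I) = 2 * real_of_int N + 1 + real H"
    using \<open>N \<ge> 0\<close> by (simp add: I_def)
  define f where "f x = (indicator B x :: real)" for x :: int
  have pair: "(\<Sum>x\<in>I. f (x + int h) * f (x + int h')) = real (card B) * corr B (int h - int h')"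
    if "h < H" "h' < H" for h h'
  proof -
    have "(\<Sum>x\<in>I. f (x + int h) * f (x + int h'))
        = (\<Sum>x\<in>I. if x + int h \<in> B \<and> x + int h' \<in> B then 1 else 0)"
      by (intro sum.cong refl) (auto simp: f_def indicator_def)
    also have "\<dots> = real (card {x \<in> I. x + int h \<in> B \<and> x + int h' \<in> B})"
      by (subst sum.If_cases) (auto simp: I_def Int_def)
    also have "card {x \<in> I. x + int h \<in> B \<and> x + int h' \<in> B}
        = card {x \<in> B. x + (int h - int h') \<in> B}"
    proof (rule bij_betw_same_card, rule bij_betw_byWitness [where f = "\<lambda>x. x + int h'" and f' = "\<lambda>x. x - int h'"])
      show "\<forall>x\<in>{x \<in> I. x + int h \<in> B \<and> x + int h' \<in> B}. (x + int h') - int h' = x" by simp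
      show "\<forall>x\<in>{x \<in> B. x + (int h - int h') \<in> B}. (x - int h') + int h' = x" by simp
      show "(\<lambda>x. x + int h') ` {x \<in> I. x + int h \<in> B \<and> x + int h' \<in> B}
          \<subseteq> {x \<in> B. x + (int h - int h') \<in> B}" by auto
      show "(\<lambda>x. x - int h') ` {x \<in> B. x + (int h - int h') \<in> B}
          \<subseteq> {x \<in> I. x + int h \<in> B \<and> x + int h' \<in> B}"
        using B(1) that by (auto simp: I_def algebra_simps dest!: subsetD)
    qed
    finally show ?thesis
      using fin B(2) by (simp add: corr_def)
  qed
  define g where "g x = (\<Sum>h<H. f (x + int h))" for x
  have "(\<Sum>x\<in>I. g x) = (\<Sum>h<H. \<Sum>x\<in>I. f (x + int h) * f (x + int h))"
    unfolding g_def by (subst sum.swap) (intro sum.cong refl, simp add: f_def indicator_def)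
  also have "\<dots> = (\<Sum>h<H. real (card B) * corr B 0)"
    by (intro sum.cong refl) (use pair in auto)
  also have "\<dots> = real H * real (card B)"
    using fin B(2) by (simp add: corr_def)
  finally have 1: "(\<Sum>x\<in>I. g x) = real H * real (card B)" .
  have "(\<Sum>x\<in>I. (g x)\<^sup>2) = (\<Sum>x\<in>I. \<Sum>h<H. \<Sum>h'<H. f (x + int h) * f (x + int h'))"
    by (simp add: g_def power2_eq_square sum_product)
  also have "\<dots> = (\<Sum>h<H. \<Sum>x\<in>I. \<Sum>h'<H. f (x + int h) * f (x + int h'))"
    by (rule sum.swap)
  also have "\<dots> = (\<Sum>h<H. \<Sum>h'<H. \<Sum>x\<in>I. f (x + int h) * f (x + int h'))"
    by (intro sum.cong refl sum.swap)
  also have "\<dots> = (\<Sum>h<H. \<Sum>h'<H. real (card B) * corr B (int h - int h'))"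
    by (intro sum.cong refl pair) auto
  also have "\<dots> = real (card B) * (\<Sum>h<H. \<Sum>h'<H. corr B (int h - int h'))"
    by (simp add: sum_distrib_left)
  finally have 2: "(\<Sum>x\<in>I. (g x)\<^sup>2) = real (card B) * (\<Sum>h<H. \<Sum>h'<H. corr B (int h - int h'))" .
  have "(\<Sum>x\<in>I. g x)\<^sup>2 \<le> (\<Sum>x\<in>I. (g x)\<^sup>2) * real (card I)"
    using sum_squared_le_sum_of_squares [of g I] by simp
  then have "(real H)\<^sup>2 * (real (card B))\<^sup>2
      \<le> real (card B) * (\<Sum>h<H. \<Sum>h'<H. corr B (int h - int h')) * (2 * real_of_int N + 1 + real H)"
    unfolding 1 2 cardI by (simp add: power_mult_distrib)
  then have "real (card B) * ((real H)\<^sup>2 * real (card B))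
      \<le> real (card B) * ((\<Sum>h<H. \<Sum>h'<H. corr B (int h - int h')) * (2 * real_of_int N + 1 + real H))"
    by (simp add: power2_eq_square mult_ac)
  moreover have "real (card B) > 0" using fin B(2) by (simp add: card_gt_0_iff)
  ultimately have "(real H)\<^sup>2 * real (card B)
      \<le> (\<Sum>h<H. \<Sum>h'<H. corr B (int h - int h')) * (2 * real_of_int N + 1 + real H)"
    by (simp only: mult_le_cancel_left_pos)
  then show ?thesis
    using \<open>N \<ge> 0\<close> by (subst pos_divide_le_eq) auto
qed

section \<open>The spectral measure of a finite set\<close>

lemma has_bochner_integral_ee:
  "has_bochner_integral lborel (\<lambda>x. indicator {0..1} x *\<^sub>R ee (real_of_int h * x)) (if h = 0 then 1 else 0)"
proof (cases "h = 0")
  case True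
  have "has_bochner_integral lborel (\<lambda>x :: real. indicator {0..1} x *\<^sub>R (1 :: complex))
      (measure lborel {0..1 :: real} *\<^sub>R 1)"
    by (rule has_bochner_integral_indicator) auto
  then show ?thesis using True by simp
next
  case False
  define F where "F x = ee (real_of_int h * x) / (2 * pi * h * \<i>)" for x
  have "((\<lambda>x. ee (real_of_int h * x)) has_vector_derivative (2 * pi * h * \<i>) * ee (real_of_int h * x)) (at x within A)"
    for x A
    unfolding ee_def cis_conv_exp
    by (auto intro!: derivative_eq_intros has_vector_derivative_real_field)
  then have "(F has_vector_derivative ee (real_of_int h * x)) (at x within A)" for x A
    unfolding F_def using False
    by (auto intro!: derivative_eq_intros)
  then have "has_bochner_integral lborel (\<lambda>x. indicator {0..1} x *\<^sub>R ee (real_of_int h * x)) (F 1 - F 0)"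
    by (intro has_bochner_integral_FTC_Icc) (auto intro!: continuous_intros)
  moreover have "ee (real_of_int h) = 1" by (simp add: ee_eq_1_iff)
  ultimately show ?thesis using False by (simp add: F_def)
qed

text \<open>The measure whose Fourier coefficients are the correlations of \<open>B\<close>.\<close>

definition spec_density :: "int set \<Rightarrow> real \<Rightarrow> real" where
  "spec_density B \<theta> = indicator {0..1} \<theta> * (norm (\<Sum>x\<in>B. ee (real_of_int x * \<theta>)))\<^sup>2 / real (card B)"

text \<open>A measure on the line rather than on the circle, so that Helly selection for real
  distributions is available. The endpoints 0 and 1 are then different points, and the atom at the
  trivial character becomes the mass of \<open>\<int>\<close>.\<close>

definition spec :: "int set \<Rightarrow> real measure" where
  "spec B = density lborel (\<lambda>\<theta>. ennreal (spec_density B \<theta>))"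

lemma spec_density_nonneg: "0 \<le> spec_density B \<theta>"
  by (simp add: spec_density_def)

lemma spec_density_measurable [measurable]: "spec_density B \<in> borel_measurable borel"
  unfolding spec_density_def by measurable

text \<open>Expanding the square gives the phases \<open>ee ((h + x - y) * \<theta>)\<close>;
  orthogonality on the unit interval keeps exactly the pairs with \<open>y = x + h\<close>.\<close>

lemma has_bochner_integral_spec_density:
  assumes "finite B"
  shows "has_bochner_integral lborel (\<lambda>\<theta>. spec_density B \<theta> *\<^sub>R ee (real_of_int h * \<theta>)) (of_real (corr B h))"
proof -
  have "spec_density B \<theta> *\<^sub>R ee (real_of_int h * \<theta>)
      = (\<Sum>x\<in>B. \<Sum>y\<in>B. indicator {0..1} \<theta> *\<^sub>R ee (real_of_int (h + x - y) * \<theta>)) / of_nat (card B)" for \<theta>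
  proof -
    have "spec_density B \<theta> *\<^sub>R ee (real_of_int h * \<theta>)
        = of_real (indicator {0..1} \<theta>) * (ee (real_of_int h * \<theta>) *
          ((\<Sum>x\<in>B. ee (real_of_int x * \<theta>)) * cnj (\<Sum>x\<in>B. ee (real_of_int x * \<theta>)))) / of_nat (card B)"
      by (simp add: spec_density_def scaleR_conv_of_real complex_norm_square del: of_real_power cnj_sum)
    also have "ee (real_of_int h * \<theta>) * ((\<Sum>x\<in>B. ee (real_of_int x * \<theta>)) * cnj (\<Sum>x\<in>B. ee (real_of_int x * \<theta>)))
        = (\<Sum>x\<in>B. \<Sum>y\<in>B. ee (real_of_int (h + x - y) * \<theta>))"
      unfolding cnj_sum sum_product ee_mult_cnj
      by (simp add: sum_distrib_left ee_add [symmetric] algebra_simps)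
    finally show ?thesis
      by (simp add: sum_distrib_left scaleR_conv_of_real)
  qed
  moreover have "has_bochner_integral lborel
      (\<lambda>\<theta>. (\<Sum>x\<in>B. \<Sum>y\<in>B. indicator {0..1} \<theta> *\<^sub>R ee (real_of_int (h + x - y) * \<theta>)) / of_nat (card B))
      ((\<Sum>x\<in>B. \<Sum>y\<in>B. if h + x - y = 0 then 1 else 0) / of_nat (card B))"
    by (intro has_bochner_integral_divide has_bochner_integral_sum has_bochner_integral_ee)
  moreover have "(\<Sum>x\<in>B. \<Sum>y\<in>B. if h + x - y = 0 then 1 else 0) = (of_nat (card {x \<in> B. x + h \<in> B}) :: complex)"
  proof -
    have "(\<Sum>x\<in>B. \<Sum>y\<in>B. if h + x - y = 0 then 1 else 0)
        = (\<Sum>x\<in>B. \<Sum>y\<in>B. if y = x + h then 1 else (0 :: complex))"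
      by (intro sum.cong) auto
    also have "\<dots> = (\<Sum>x\<in>B. if x + h \<in> B then 1 else 0)"
      using assms by simp
    also have "\<dots> = of_nat (card {x \<in> B. x + h \<in> B})"
      using assms by (subst sum.If_cases) (auto simp: Int_def)
    finally show ?thesis .
  qed
  ultimately show ?thesis by (simp add: corr_def)
qed

text \<open>The total mass is \<open>corr B 0 = 1\<close> and sits on the unit interval. The set
  \<open>A\<close> is general because the whole line is needed for a probability measure and a
  bounded interval for tightness.\<close>

lemma emeasure_spec:
  assumes "finite B" "B \<noteq> {}" and [measurable]: "A \<in> sets borel" and "{0..1} \<subseteq> A"
  shows "emeasure (spec B) A = 1"
proof -
  have "has_bochner_integral lborel (\<lambda>\<theta>. complex_of_real (spec_density B \<theta>)) (of_real (corr B 0))"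
    using has_bochner_integral_spec_density [OF assms(1), of 0] by (simp add: scaleR_conv_of_real)
  then have "has_bochner_integral lborel (spec_density B) (corr B 0)"
    using has_bochner_integral_bounded_linear [OF bounded_linear_Re] by fastforce
  moreover have "corr B 0 = 1"
    using assms(1,2) by (simp add: corr_def)
  ultimately have "(\<integral>\<^sup>+\<theta>. ennreal (spec_density B \<theta>) \<partial>lborel) = 1"
    by (subst nn_integral_eq_integral) (auto simp: has_bochner_integral_iff spec_density_nonneg)
  moreover have "ennreal (spec_density B \<theta>) * indicator A \<theta> = ennreal (spec_density B \<theta>)" for \<theta>
    using assms(4) by (auto simp: spec_density_def indicator_def)
  ultimately show ?thesis
    by (simp add: spec_def emeasure_density)
qed

lemma real_distribution_spec:
  assumes "finite B" "B \<noteq> {}"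
  shows "real_distribution (spec B)"
proof -
  have "prob_space (spec B)"
    by (rule prob_spaceI) (use emeasure_spec [OF assms, of UNIV] in \<open>simp add: spec_def\<close>)
  then interpret prob_space "spec B" .
  show ?thesis by standard (auto simp: spec_def)
qed

lemma integral_spec_ee:
  assumes "finite B"
  shows "(\<integral>\<theta>. ee (real_of_int h * \<theta>) \<partial>spec B) = of_real (corr B h)"
  unfolding spec_def
  by (subst integral_density)
    (use has_bochner_integral_spec_density [OF assms] in \<open>auto simp: spec_density_nonneg has_bochner_integral_iff\<close>)

text \<open>The measures are carried by the unit interval, hence tight, so a subsequence converges
  weakly. Testing against the bounded continuous functions \<open>ee (h * \<theta>)\<close> turns
  this into convergence of every correlation.\<close>

lemma spectral_limit:
  assumes B: "\<And>t :: nat. finite (B t)" "\<And>t. B t \<noteq> {}"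
  obtains \<sigma> \<mu> where "strict_mono (\<sigma> :: nat \<Rightarrow> nat)" and "real_distribution \<mu>"
    and "\<And>h. (\<lambda>t. complex_of_real (corr (B (\<sigma> t)) h)) \<longlonglongrightarrow> (\<integral>\<theta>. ee (real_of_int h * \<theta>) \<partial>\<mu>)"
proof -
  have "tight (\<lambda>t. spec (B t))"
    unfolding tight_def
  proof (intro conjI allI impI)
    fix \<epsilon> :: real
    assume "\<epsilon> > 0"
    have "measure (spec (B t)) {-1<..2} = 1" for t
      using emeasure_spec [OF B, of "{-1<..2}" t] by (simp add: measure_def subset_iff)
    then show "\<exists>a b. a < b \<and> (\<forall>t. 1 - \<epsilon> < measure (spec (B t)) {a<..b})"
      using \<open>\<epsilon> > 0\<close> by (intro exI [of _ "-1"] exI [of _ 2]) auto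
  qed (intro real_distribution_spec B)
  from tight_imp_convergent_subsubsequence [OF this, of id]
  obtain \<sigma> \<mu> where \<sigma>: "strict_mono \<sigma>" and \<mu>: "real_distribution \<mu>"
    and conv: "weak_conv_m (\<lambda>t. spec (B (\<sigma> t))) \<mu>"
    by (auto simp: strict_mono_def comp_def)
  have "(\<lambda>t. complex_of_real (corr (B (\<sigma> t)) h)) \<longlonglongrightarrow> (\<integral>\<theta>. ee (real_of_int h * \<theta>) \<partial>\<mu>)" for h
  proof -
    have "continuous_on UNIV (\<lambda>\<theta>. ee (real_of_int h * \<theta>))"
      by (intro continuous_intros)
    then have "isCont (\<lambda>\<theta>. ee (real_of_int h * \<theta>)) \<theta>" for \<theta>
      by (simp add: continuous_on_eq_continuous_at)
    from weak_conv_imp_integral_bdd_continuous_conv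
      [OF real_distribution_spec [OF B] \<mu> conv this, where B = 1]
    show ?thesis by (simp add: integral_spec_ee B)
  qed
  with \<sigma> \<mu> show ?thesis by (rule that)
qed

lemma integrable_ee:
  assumes "real_distribution \<mu>"
  shows "integrable \<mu> (\<lambda>\<theta>. ee (c * \<theta>))"
proof -
  interpret real_distribution \<mu> by fact
  show ?thesis
    by (rule integrable_const_bound [where B = 1]) auto
qed

text \<open>The squared averages \<open>K H\<close> tend boundedly to the indicator of
  \<open>\<int>\<close>. For fixed \<open>H\<close> the integral of \<open>K H\<close> is a limit of
  mean correlations, which \<open>corr_sum_ge\<close> keeps above a quantity tending to
  \<open>\<delta>\<close>.\<close>

lemma measure_Ints_ge:
  assumes \<mu>: "real_distribution \<mu>"
    and conv: "\<And>h. (\<lambda>t. complex_of_real (corr (B t) h)) \<longlonglongrightarrow> (\<integral>\<theta>. ee (real_of_int h * \<theta>) \<partial>\<mu>)"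
    and B: "\<And>t. B t \<subseteq> {- int (N t)..int (N t)}" "\<And>t. B t \<noteq> {}"
    and N: "\<And>t. t \<le> N t" and card: "\<And>t. real (card (B t)) \<ge> \<delta> * (2 * real (N t) + 1)"
    and "\<delta> > 0"
  shows "\<delta> \<le> measure \<mu> \<int>"
proof -
  interpret real_distribution \<mu> by fact
  have Z [measurable]: "(\<int> :: real set) \<in> sets borel"
    by (intro borel_closed) simp
  define K where "K H \<theta> = (norm (avg (\<lambda>s. ee (\<theta> * real s)) H))\<^sup>2" for H \<theta>
  have K1: "norm (K H \<theta>) \<le> 1" for H \<theta>
    unfolding K_def by (simp add: power_le_one norm_avg_le)
  have [measurable]: "K H \<in> borel_measurable borel" for H
    unfolding K_def avg_def by measurable
  have "(\<lambda>H. \<integral>\<theta>. K H \<theta> \<partial>\<mu>) \<longlonglongrightarrow> (\<integral>\<theta>. indicator \<int> \<theta> \<partial>\<mu>)"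
  proof (rule integral_dominated_convergence [where w = "\<lambda>_. 1"])
    have "(\<lambda>H. K H \<theta>) \<longlonglongrightarrow> indicator \<int> \<theta>" for \<theta>
    proof (cases "\<theta> \<in> \<int>")
      case True
      then have "ee (\<theta> * real s) = 1" for s
        by (simp add: ee_eq_1_iff)
      then have "K H \<theta> = 1" if "H > 0" for H
        using that by (simp add: K_def avg_def)
      then have "\<forall>\<^sub>F H in sequentially. K H \<theta> = 1"
        using eventually_gt_at_top [of 0] by (rule eventually_mono [rotated])
      then show ?thesis using True by (simp add: tendsto_eventually)
    next
      case False
      then have "avg (\<lambda>s. ee (\<theta> * real s)) \<longlonglongrightarrow> 0"
        using avg_ee_linear [of \<theta> 0] by simp
      then have "(\<lambda>H. K H \<theta>) \<longlonglongrightarrow> (norm (0 :: complex))\<^sup>2"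
        unfolding K_def by (intro tendsto_intros)
      then show ?thesis using False by simp
    qed
    then show "AE \<theta> in \<mu>. (\<lambda>H. K H \<theta>) \<longlonglongrightarrow> indicator \<int> \<theta>" by simp
  qed (use K1 in auto)
  then have lim: "(\<lambda>H. \<integral>\<theta>. K H \<theta> \<partial>\<mu>) \<longlonglongrightarrow> measure \<mu> \<int>" by simp
  have "\<delta> \<le> (\<integral>\<theta>. K H \<theta> \<partial>\<mu>)" if "H > 0" for H
  proof -
    define S where "S = (\<Sum>h<H. \<Sum>h'<H. \<integral>\<theta>. ee (real_of_int (int h - int h') * \<theta>) \<partial>\<mu>)"
    have "complex_of_real (K H \<theta>) = (\<Sum>h<H. \<Sum>h'<H. ee (real_of_int (int h - int h') * \<theta>)) / (of_nat H)\<^sup>2" for \<theta>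
    proof -
      have "complex_of_real (K H \<theta>) = ((\<Sum>h<H. ee (\<theta> * real h)) * cnj (\<Sum>h<H. ee (\<theta> * real h))) / (of_nat H)\<^sup>2"
        unfolding K_def avg_def by (simp add: norm_divide power_divide complex_norm_square [symmetric] del: cnj_sum)
      also have "(\<Sum>h<H. ee (\<theta> * real h)) * cnj (\<Sum>h<H. ee (\<theta> * real h))
          = (\<Sum>h<H. \<Sum>h'<H. ee (real_of_int (int h - int h') * \<theta>))"
        by (simp add: sum_product ee_mult_cnj algebra_simps)
      finally show ?thesis .
    qed
    then have "(\<integral>\<theta>. complex_of_real (K H \<theta>) \<partial>\<mu>) = S / (of_nat H)\<^sup>2"
      unfolding S_def by (simp add: Bochner_Integration.integral_sum integrable_ee [OF \<mu>] Bochner_Integration.integrable_sum)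
    then have SK: "S / (of_nat H)\<^sup>2 = of_real (\<integral>\<theta>. K H \<theta> \<partial>\<mu>)" by simp
    have "(\<lambda>t. complex_of_real ((\<Sum>h<H. \<Sum>h'<H. corr (B t) (int h - int h')) / (real H)\<^sup>2)) \<longlonglongrightarrow> S / (of_nat H)\<^sup>2"
      unfolding S_def of_real_divide of_real_sum of_real_power of_real_of_nat_eq
      using that by (intro tendsto_intros conv) auto
    then have lim1: "(\<lambda>t. (\<Sum>h<H. \<Sum>h'<H. corr (B t) (int h - int h')) / (real H)\<^sup>2) \<longlonglongrightarrow> (\<integral>\<theta>. K H \<theta> \<partial>\<mu>)"
      unfolding SK tendsto_of_real_iff .
    \<comment> \<open>The windows grow, so for fixed \<open>H\<close> the boundary term
      \<open>H\<close> in the denominator is negligible.\<close>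
    have "filterlim N at_top sequentially"
      using N by (intro filterlim_at_top_mono [OF filterlim_ident]) auto
    moreover have "((\<lambda>n. \<delta> * (2 * real n + 1) / (2 * real n + 1 + real H)) \<longlongrightarrow> \<delta>) sequentially"
      by real_asymp
    ultimately have lim2: "(\<lambda>t. \<delta> * (2 * real (N t) + 1) / (2 * real (N t) + 1 + real H)) \<longlonglongrightarrow> \<delta>"
      by (rule filterlim_compose [rotated])
    have "\<delta> * (2 * real (N t) + 1) / (2 * real (N t) + 1 + real H)
        \<le> (\<Sum>h<H. \<Sum>h'<H. corr (B t) (int h - int h')) / (real H)\<^sup>2" for t
    proof -
      have "\<delta> * (2 * real (N t) + 1) / (2 * real (N t) + 1 + real H)
          \<le> real (card (B t)) / (2 * real (N t) + 1 + real H)"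
        using card [of t] by (intro divide_right_mono) auto
      also have "\<dots> = (real H ^ 2 * real (card (B t)) / (2 * real (N t) + 1 + real H)) / (real H)\<^sup>2"
        using that by simp
      also have "\<dots> \<le> (\<Sum>h<H. \<Sum>h'<H. corr (B t) (int h - int h')) / (real H)\<^sup>2"
        using corr_sum_ge [OF B, of H t] by (intro divide_right_mono) auto
      finally show ?thesis .
    qed
    then show ?thesis
      by (intro LIMSEQ_le [OF lim2 lim1]) auto
  qed
  then show ?thesis
    by (intro LIMSEQ_le_const [OF lim]) (auto intro!: exI [of _ 1])
qed


section \<open>Restricted averages of powers\<close>

text \<open>Twice the Fejer kernel normalised to peak value 1. The factor 2 keeps the value above 1
  on a whole neighbourhood of the integers, while the mean over a period is only
  \<open>2 / M\<close>.\<close>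

definition fejer :: "nat \<Rightarrow> real \<Rightarrow> real" where
  "fejer M t = 2 * (norm (avg (\<lambda>m. ee (real m * t)) M))\<^sup>2"

lemma fejer_nonneg: "0 \<le> fejer M t"
  by (simp add: fejer_def)

lemma fejer_le: "fejer M t \<le> 2"
proof -
  have "norm (avg (\<lambda>m. ee (real m * t)) M) \<le> 1"
    by (rule norm_avg_le) auto
  then show ?thesis by (simp add: fejer_def power_le_one)
qed

lemma fejer_expand:
  "complex_of_real (fejer M t)
    = (\<Sum>m<M. \<Sum>m'<M. ee (real_of_int (int m - int m') * t)) * 2 / (of_nat M)\<^sup>2"
proof -
  have "complex_of_real (fejer M t)
      = ((\<Sum>m<M. ee (real m * t)) * cnj (\<Sum>m<M. ee (real m * t))) * 2 / (of_nat M)\<^sup>2"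
    unfolding fejer_def avg_def
    by (simp add: norm_divide power_divide complex_norm_square [symmetric] del: cnj_sum)
  also have "(\<Sum>m<M. ee (real m * t)) * cnj (\<Sum>m<M. ee (real m * t))
      = (\<Sum>m<M. \<Sum>m'<M. ee (real_of_int (int m - int m') * t))"
    by (simp add: sum_product ee_mult_cnj algebra_simps)
  finally show ?thesis .
qed

text \<open>On the unit circle \<open>norm (z ^ m - 1) \<le> m * norm (z - 1)\<close>, so all terms
  of the average lie within 1/4 of 1. Its norm is then at least 3/4, and twice the square of that is
  9/8.\<close>

lemma fejer_ge_1:
  assumes "M > 0" and "norm (ee t - 1) < 1 / (4 * real M)"
  shows "1 \<le> fejer M t"
proof -
  have "norm (avg (\<lambda>m. ee (real m * t) - 1) M) \<le> 1 / 4"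
  proof -
    have "norm (\<Sum>m<M. ee (real m * t) - 1) \<le> (\<Sum>m<M. 1 / 4)"
    proof (rule sum_norm_le)
      fix m assume "m \<in> {..<M}"
      have "norm (ee (real m * t) - 1) \<le> real m * norm (ee t - 1)"
        using norm_power_diff [of "ee t" 1 m] by (simp add: ee_power)
      also have "\<dots> \<le> real M * norm (ee t - 1)"
        using \<open>m \<in> {..<M}\<close> by (intro mult_right_mono) auto
      also have "\<dots> \<le> 1 / 4"
        using assms by (simp add: field_simps)
      finally show "norm (ee (real m * t) - 1) \<le> 1 / 4" .
    qed
    then show ?thesis
      using assms(1) by (simp add: avg_def norm_divide field_simps)
  qed
  moreover have "avg (\<lambda>m. ee (real m * t) - 1) M = avg (\<lambda>m. ee (real m * t)) M - 1"
    using assms(1) by (simp add: avg_def sum_subtractf diff_divide_distrib)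
  ultimately have "norm (avg (\<lambda>m. ee (real m * t)) M - 1) \<le> 1 / 4" by simp
  then have "3 / 4 \<le> norm (avg (\<lambda>m. ee (real m * t)) M)"
    using norm_triangle_ineq2 [of 1 "1 - avg (\<lambda>m. ee (real m * t)) M"]
    by (simp add: norm_minus_commute)
  then have "(3 / 4)\<^sup>2 \<le> (norm (avg (\<lambda>m. ee (real m * t)) M))\<^sup>2"
    by (intro power_mono) auto
  then show ?thesis by (simp add: fejer_def power2_eq_square)
qed

lemma avg_const: "avg (\<lambda>s. c) \<longlonglongrightarrow> c"
proof (rule tendsto_eventually)
  have "avg (\<lambda>s. c) n = c" if "n > 0" for n
    using that by (simp add: avg_def)
  then show "\<forall>\<^sub>F n in sequentially. avg (\<lambda>s. c) n = c"
    using eventually_gt_at_top [of 0] by (rule eventually_mono [rotated])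
qed

lemma avg_sum: "avg (\<lambda>s. \<Sum>i\<in>I. f i s) n = (\<Sum>i\<in>I. avg (f i) n)"
  unfolding avg_def by (subst sum.swap) (simp add: sum_divide_distrib)

lemma avg_diff: "avg (\<lambda>s. f s - g s) n = avg f n - avg g n"
  by (simp add: avg_def sum_subtractf diff_divide_distrib)

lemma avg_mult_right: "avg (\<lambda>s. f s * c) n = avg f n * c"
  by (simp add: avg_def sum_distrib_right)

text \<open>If \<open>k\<close> is the larger exponent, or \<open>m = 0\<close>, the leading
  coefficient is a nonzero integer multiple of \<open>\<theta>\<close>; otherwise it is one of
  \<open>\<alpha>\<close>. As \<open>l \<noteq> k\<close>, the two irrational coefficients never
  meet in one degree.\<close>

lemma avg_phase_irrational:
  fixes q :: nat and m :: int
  assumes "\<alpha> \<notin> \<rat>" "\<theta> \<notin> \<rat>" "q > 0" "k > 0" "l \<noteq> k"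
  shows "avg (\<lambda>s. ee (real_of_int m * (\<alpha> * real (q * s) ^ l)) * ee (\<theta> * real (q * s) ^ k)) \<longlonglongrightarrow> 0"
proof -
  have irr: "real_of_int z * real q ^ j * x \<notin> \<rat>" if "x \<notin> \<rat>" "z \<noteq> 0" for z j x
    using of_int_mult_irrational [OF that(1), of "z * int q ^ j"] that assms by simp
  let ?a = "real_of_int m * real q ^ l * \<alpha>" and ?b = "real_of_int 1 * real q ^ k * \<theta>"
  have eq: "ee (real_of_int m * (\<alpha> * real (q * s) ^ l)) * ee (\<theta> * real (q * s) ^ k)
      = ee (?a * real s ^ l + ?b * real s ^ k)" for s
    by (simp add: ee_add [symmetric] power_mult_distrib mult_ac add.commute)
  consider "l < k" | "k < l" "m \<noteq> 0" | "m = 0"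
    using assms(5) by linarith
  then show ?thesis
  proof cases
    case 1
    have "avg (\<lambda>s. ee (?b * real s ^ k + ?a * real s ^ l)) \<longlonglongrightarrow> 0"
      by (intro weyl_two_terms irr 1 assms) auto
    then show ?thesis unfolding eq by (simp add: add.commute)
  next
    case 2
    have "avg (\<lambda>s. ee (?a * real s ^ l + ?b * real s ^ k)) \<longlonglongrightarrow> 0"
      by (intro weyl_two_terms irr 2 assms)
    then show ?thesis unfolding eq .
  next
    case 3
    have "avg (\<lambda>s. ee (?b * real s ^ k + 0 * real s ^ 0)) \<longlonglongrightarrow> 0"
      by (intro weyl_two_terms irr assms) auto
    then show ?thesis unfolding eq using 3 by simp
  qed
qed

text \<open>Since \<open>k > 0\<close>, the power \<open>(q * s) ^ k\<close> contains a factor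
  \<open>q\<close>, and the argument is an integer multiple of \<open>q * \<theta>\<close>.\<close>

lemma ee_multiple_power:
  fixes q :: nat
  assumes "real q * \<theta> \<in> \<int>" "k > 0"
  shows "ee (\<theta> * real (q * s) ^ k) = 1"
proof -
  obtain k' where k: "k = Suc k'" using assms(2) by (cases k) auto
  have "\<theta> * real (q * s) ^ k = (real q * \<theta>) * real (s * (q * s) ^ k')"
    by (simp add: k)
  also have "\<dots> \<in> \<int>"
    by (intro Ints_mult assms Ints_of_nat)
  finally show ?thesis by (simp add: ee_eq_1_iff)
qed

text \<open>Serves the \<open>\<theta>\<close> with \<open>q * \<theta>\<close> an integer, where
  the phase in \<open>\<theta>\<close> is constantly 1; only frequency 0 survives.\<close>

lemma avg_phase_rational:
  fixes q :: nat and m :: int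
  assumes "\<alpha> \<notin> \<rat>" "q > 0" "l > 0"
  shows "avg (\<lambda>s. ee (real_of_int m * (\<alpha> * real (q * s) ^ l))) \<longlonglongrightarrow> (if m = 0 then 1 else 0)"
proof (cases "m = 0")
  case True
  then show ?thesis using avg_const [of 1] by simp
next
  case False
  have "real_of_int (m * int q ^ l) * \<alpha> \<notin> \<rat>"
    using False assms by (intro of_int_mult_irrational) auto
  then have "avg (\<lambda>s. ee ((real_of_int (m * int q ^ l) * \<alpha>) * real s ^ l + 0 * real s ^ 0)) \<longlonglongrightarrow> 0"
    using assms(3) by (intro weyl_two_terms)
  then show ?thesis
    using False by (simp add: power_mult_distrib mult_ac)
qed

lemma avg_fejer_irrational:
  fixes q :: nat
  assumes "\<alpha> \<notin> \<rat>" "\<theta> \<notin> \<rat>" "q > 0" "k > 0" "l \<noteq> k"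
  shows "avg (\<lambda>s. of_real (fejer M (\<alpha> * real (q * s) ^ l)) * ee (\<theta> * real (q * s) ^ k)) \<longlonglongrightarrow> 0"
proof -
  have eq: "avg (\<lambda>s. of_real (fejer M (\<alpha> * real (q * s) ^ l)) * ee (\<theta> * real (q * s) ^ k)) n
      = (\<Sum>m<M. \<Sum>m'<M. avg (\<lambda>s. ee (real_of_int (int m - int m') * (\<alpha> * real (q * s) ^ l))
          * ee (\<theta> * real (q * s) ^ k)) n) * (2 / (of_nat M)\<^sup>2)" for n
    unfolding fejer_expand avg_sum [symmetric] avg_mult_right [symmetric]
    by (intro arg_cong [where f = "\<lambda>u. avg u n"] ext) (simp add: sum_distrib_left sum_distrib_right sum_divide_distrib mult_ac)
  have "(\<lambda>n. (\<Sum>m<M. \<Sum>m'<M. avg (\<lambda>s. ee (real_of_int (int m - int m') * (\<alpha> * real (q * s) ^ l))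
          * ee (\<theta> * real (q * s) ^ k)) n) * (2 / (of_nat M)\<^sup>2)) \<longlonglongrightarrow> (\<Sum>m<M. \<Sum>m'<M. 0) * (2 / (of_nat M)\<^sup>2)"
    by (intro tendsto_mult tendsto_sum tendsto_const avg_phase_irrational assms)
  then show ?thesis unfolding eq [symmetric] by simp
qed

text \<open>Of the \<open>M^2\<close> pairs in the expansion only the \<open>M\<close> diagonal ones
  have frequency 0, whence \<open>2 * M / M^2\<close>.\<close>

lemma avg_fejer_rational:
  fixes q :: nat
  assumes "\<alpha> \<notin> \<rat>" "q > 0" "l > 0" "M > 0"
  shows "avg (\<lambda>s. of_real (fejer M (\<alpha> * real (q * s) ^ l))) \<longlonglongrightarrow> of_real (2 / real M)"
proof -
  have eq: "avg (\<lambda>s. of_real (fejer M (\<alpha> * real (q * s) ^ l))) n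
      = (\<Sum>m<M. \<Sum>m'<M. avg (\<lambda>s. ee (real_of_int (int m - int m') * (\<alpha> * real (q * s) ^ l))) n)
          * (2 / (of_nat M)\<^sup>2)" for n
    unfolding fejer_expand avg_sum [symmetric] avg_mult_right [symmetric] by simp
  have "(\<lambda>n. (\<Sum>m<M. \<Sum>m'<M. avg (\<lambda>s. ee (real_of_int (int m - int m') * (\<alpha> * real (q * s) ^ l))) n)
          * (2 / (of_nat M)\<^sup>2)) \<longlonglongrightarrow> (\<Sum>m<M. \<Sum>m'<M. if int m - int m' = 0 then 1 else 0) * (2 / (of_nat M)\<^sup>2)"
    by (intro tendsto_mult tendsto_sum tendsto_const avg_phase_rational assms)
  moreover have "(\<Sum>m<M. \<Sum>m'<M. if int m - int m' = 0 then 1 else 0) * (2 / (of_nat M)\<^sup>2) = (of_real (2 / real M) :: complex)"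
    using assms(4) by (simp add: power2_eq_square)
  ultimately show ?thesis unfolding eq [symmetric] by (simp only:)
qed

text \<open>A union bound over \<open>L\<close> instead of a product of cut-off functions: the weight is nonpositive as
  soon as one Fejer kernel is at least 1, and each phase in its expansion involves only one
  exponent \<open>l\<close>. The mean is \<open>1 - (\<Sum>l\<in>L. 2 / 2 ^ (l + 3)) \<ge> 1 / 2\<close>, however large \<open>L\<close> is.\<close>

definition weight :: "real \<Rightarrow> nat set \<Rightarrow> nat \<Rightarrow> real" where
  "weight \<alpha> L r = 1 - (\<Sum>l\<in>L. fejer (2 ^ (l + 3)) (\<alpha> * real r ^ l))"

lemma weight_pos_imp:
  assumes "finite L" "l \<in> L" "weight \<alpha> L r > 0"
  shows "fejer (2 ^ (l + 3)) (\<alpha> * real r ^ l) < 1"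
  using assms member_le_sum [of l L "\<lambda>l. fejer (2 ^ (l + 3)) (\<alpha> * real r ^ l)"]
  by (simp add: weight_def fejer_nonneg)

lemma abs_weight_le: "\<bar>weight \<alpha> L r\<bar> \<le> 1 + 2 * real (card L)"
proof -
  have "(\<Sum>l\<in>L. fejer (2 ^ (l + 3)) (\<alpha> * real r ^ l)) \<le> (\<Sum>l\<in>L. 2)"
    by (intro sum_mono fejer_le)
  moreover have "0 \<le> (\<Sum>l\<in>L. fejer (2 ^ (l + 3)) (\<alpha> * real r ^ l))"
    by (intro sum_nonneg fejer_nonneg)
  ultimately show ?thesis by (simp add: weight_def)
qed

lemma avg_weight_irrational:
  fixes q :: nat
  assumes "\<alpha> \<notin> \<rat>" "\<theta> \<notin> \<rat>" "q > 0" "k > 0" "k \<notin> L"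
  shows "avg (\<lambda>s. of_real (weight \<alpha> L (q * s)) * ee (\<theta> * real (q * s) ^ k)) \<longlonglongrightarrow> 0"
proof -
  \<comment> \<open>The constant 1 of the weight is written as a phase with frequency 0 and exponent
    0, so that \<open>avg_phase_irrational\<close> covers it; the exponents 0 and \<open>k\<close>
    differ.\<close>
  have eq: "avg (\<lambda>s. of_real (weight \<alpha> L (q * s)) * ee (\<theta> * real (q * s) ^ k)) n
      = avg (\<lambda>s. ee (real_of_int 0 * (\<alpha> * real (q * s) ^ 0)) * ee (\<theta> * real (q * s) ^ k)) n
      - (\<Sum>l\<in>L. avg (\<lambda>s. of_real (fejer (2 ^ (l + 3)) (\<alpha> * real (q * s) ^ l)) * ee (\<theta> * real (q * s) ^ k)) n)" for n
    unfolding avg_sum [symmetric] avg_diff [symmetric] weight_def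
    by (simp add: left_diff_distrib sum_distrib_right)
  have "(\<lambda>n. avg (\<lambda>s. ee (real_of_int 0 * (\<alpha> * real (q * s) ^ 0)) * ee (\<theta> * real (q * s) ^ k)) n
      - (\<Sum>l\<in>L. avg (\<lambda>s. of_real (fejer (2 ^ (l + 3)) (\<alpha> * real (q * s) ^ l)) * ee (\<theta> * real (q * s) ^ k)) n))
      \<longlonglongrightarrow> 0 - (\<Sum>l\<in>L. 0)"
    using assms by (intro tendsto_diff tendsto_sum avg_fejer_irrational avg_phase_irrational) auto
  then show ?thesis unfolding eq [symmetric] by simp
qed

lemma avg_weight_rational:
  fixes q :: nat
  assumes "\<alpha> \<notin> \<rat>" "real q * \<theta> \<in> \<int>" "q > 0" "k > 0" "0 \<notin> L"
  shows "avg (\<lambda>s. of_real (weight \<alpha> L (q * s)) * ee (\<theta> * real (q * s) ^ k))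
    \<longlonglongrightarrow> of_real (1 - (\<Sum>l\<in>L. 2 / 2 ^ (l + 3)))"
proof -
  have eq: "avg (\<lambda>s. of_real (weight \<alpha> L (q * s)) * ee (\<theta> * real (q * s) ^ k)) n
      = avg (\<lambda>s. 1) n - (\<Sum>l\<in>L. avg (\<lambda>s. of_real (fejer (2 ^ (l + 3)) (\<alpha> * real (q * s) ^ l))) n)" for n
    unfolding avg_sum [symmetric] avg_diff [symmetric] weight_def
    using ee_multiple_power [OF assms(2,4)] by simp
  have "(\<lambda>n. avg (\<lambda>s. 1) n - (\<Sum>l\<in>L. avg (\<lambda>s. of_real (fejer (2 ^ (l + 3)) (\<alpha> * real (q * s) ^ l))) n))
      \<longlonglongrightarrow> 1 - (\<Sum>l\<in>L. of_real (2 / real (2 ^ (l + 3))))"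
    using assms by (intro tendsto_diff tendsto_sum avg_fejer_rational avg_const) (auto intro!: Nat.gr0I)
  then show ?thesis unfolding eq [symmetric] by simp
qed

lemma weight_mean_ge:
  assumes "finite L"
  shows "1 / 2 \<le> 1 - (\<Sum>l\<in>L. 2 / 2 ^ (l + 3) :: real)"
proof -
  have "(\<lambda>l. (1 / 2) ^ l * (1 / 4)) sums (1 / (1 - 1 / 2) * (1 / 4) :: real)"
    by (intro sums_mult2 geometric_sums) simp
  then have sums: "(\<lambda>l. 2 / 2 ^ (l + 3)) sums (1 / 2 :: real)"
    by (simp add: power_add power_divide mult.commute)
  have "(\<Sum>l\<in>L. 2 / 2 ^ (l + 3) :: real) \<le> (\<Sum>l. 2 / 2 ^ (l + 3))"
    using sums by (intro sum_le_suminf assms) (auto simp: sums_iff)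
  then show ?thesis using sums by (simp add: sums_iff)
qed

text \<open>Otherwise the weight times the Fourier coefficient at \<open>r ^ k\<close> has
  nonpositive real part for all \<open>r > 0\<close>. Averaging over multiples of \<open>q\<close>
  under the integral isolates, up to a small error, the points with \<open>q * \<theta>\<close> an
  integer. There the averages tend to the mean \<open>w \<ge> 1 / 2\<close> of the weight, and these
  points carry at least the mass of \<open>\<int>\<close>, a contradiction.\<close>

lemma spectral_positivity:
  assumes \<mu>: "real_distribution \<mu>" and atom: "measure \<mu> \<int> > 0"
    and nonneg: "\<And>h :: nat. 0 \<le> Re (\<integral>\<theta>. ee (real h * \<theta>) \<partial>\<mu>)"
    and \<alpha>: "\<alpha> \<notin> \<rat>" and k: "k > 0" and L: "finite L" "0 \<notin> L" "k \<notin> L"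
  shows "\<exists>r>0. weight \<alpha> L r > 0 \<and> (\<integral>\<theta>. ee (real (r ^ k) * \<theta>) \<partial>\<mu>) \<noteq> 0"
proof (rule ccontr)
  assume "\<not> ?thesis"
  then have neg: "weight \<alpha> L r \<le> 0 \<or> (\<integral>\<theta>. ee (real (r ^ k) * \<theta>) \<partial>\<mu>) = 0" if "r > 0" for r
    using that by (meson not_le)
  interpret real_distribution \<mu> by fact
  define C where "C = 1 + 2 * real (card L)"
  define w where "w = 1 - (\<Sum>l\<in>L. 2 / 2 ^ (l + 3) :: real)"
  have "w \<ge> 1 / 2" unfolding w_def by (rule weight_mean_ge) (rule L)
  have "C > 0" by (simp add: C_def)
  have [measurable]: "(\<rat> :: real set) \<in> sets borel" "(\<int> :: real set) \<in> sets borel"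
    by (auto intro: sets.countable [OF _ countable_rat] borel_closed)
  \<comment> \<open>Rational points where the average along multiples of \<open>j!\<close> has no usable limit. They carry
    little mass for large \<open>j\<close>, so they are cut out.\<close>
  define D where "D j = {\<theta>. \<theta> \<in> \<rat> \<and> real (fact j) * \<theta> \<notin> \<int>}" for j :: nat
  have [measurable]: "D j \<in> sets borel" for j
    unfolding D_def by measurable
  \<comment> \<open>A rational number leaves \<open>D j\<close> as soon as its denominator divides
    \<open>j!\<close>, so the indicators tend to 0 pointwise.\<close>
  have "(\<lambda>j. \<integral>\<theta>. indicator (D j) \<theta> \<partial>\<mu>) \<longlonglongrightarrow> (\<integral>\<theta>. (0 :: real) \<partial>\<mu>)"
  proof (rule integral_dominated_convergence [where w = "\<lambda>_. 1"])
    have "(\<lambda>j. indicator (D j) \<theta> :: real) \<longlonglongrightarrow> 0" for \<theta>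
    proof (cases "\<theta> \<in> \<rat>")
      case True
      then obtain a b where ab: "\<theta> = real_of_int a / real_of_int b" "b > 0"
        by (elim Rats_cases') auto
      have "\<theta> \<notin> D j" if "j \<ge> nat b" for j
      proof -
        have "nat b dvd fact j" using that ab(2) by (intro dvd_fact) auto
        then obtain c where c: "fact j = nat b * c" by (elim dvdE)
        have "real (fact j) * \<theta> = real_of_int (int c * a)"
          unfolding c using ab by simp
        then show ?thesis by (simp only: D_def mem_Collect_eq Ints_of_int not_True_eq_False simp_thms)
      qed
      then have "\<forall>\<^sub>F j in sequentially. indicator (D j) \<theta> = (0 :: real)"
        unfolding eventually_sequentially by (intro exI [of _ "nat b"]) simp
      then show ?thesis by (rule tendsto_eventually)
    qed (simp add: D_def)
    then show "AE \<theta> in \<mu>. (\<lambda>j. indicator (D j) \<theta> :: real) \<longlonglongrightarrow> 0" by simp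
  qed auto
  then have "(\<lambda>j. C * measure \<mu> (D j)) \<longlonglongrightarrow> C * 0"
    by (intro tendsto_mult tendsto_const) simp
  \<comment> \<open>The main term \<open>w * measure \<mu> E\<close> will be at least
    \<open>measure \<mu> \<int> / 2\<close>, which the error from \<open>D j\<close> must not
    reach.\<close>
  then have "\<forall>\<^sub>F j in sequentially. C * measure \<mu> (D j) < measure \<mu> \<int> / 2"
    using atom by (intro order_tendstoD) auto
  then obtain j where j: "C * measure \<mu> (D j) < measure \<mu> \<int> / 2"
    using eventually_happens' [OF sequentially_bot] by blast
  define q :: nat where "q = fact j"
  have "q > 0" by (simp add: q_def)
  define E where "E = {\<theta> :: real. real q * \<theta> \<in> \<int>}"
  have [measurable]: "E \<in> sets borel"
    unfolding E_def by measurable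
  define u where "u \<theta> s = of_real (weight \<alpha> L (q * s)) * ee (\<theta> * real (q * s) ^ k)" for \<theta> s
  \<comment> \<open>The shift by \<open>Suc\<close> skips \<open>s = 0\<close>, since
    \<open>neg\<close> only speaks of \<open>r > 0\<close>; the limit of the averages is
    unaffected.\<close>
  define \<Phi> where "\<Phi> n \<theta> = avg (\<lambda>s. u \<theta> (Suc s)) n" for n \<theta>
  have [measurable]: "\<Phi> n \<in> borel_measurable borel" for n
    unfolding \<Phi>_def u_def avg_def by measurable
  have u_bound: "norm (u \<theta> s) \<le> C" for \<theta> s
    using abs_weight_le [of \<alpha> L "q * s"] by (simp add: u_def norm_mult C_def)
  have \<Phi>_bound: "norm (\<Phi> n \<theta>) \<le> C" for n \<theta>
    unfolding \<Phi>_def using u_bound \<open>C > 0\<close> by (intro norm_avg_le) auto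
  have lim: "(\<lambda>n. \<Phi> n \<theta>) \<longlonglongrightarrow> of_real (w * indicator E \<theta>)" if "\<theta> \<notin> D j" for \<theta>
  proof -
    have "avg (u \<theta>) \<longlonglongrightarrow> of_real (w * indicator E \<theta>)"
    proof (cases "\<theta> \<in> E")
      case True
      then have "avg (u \<theta>) \<longlonglongrightarrow> of_real w"
        unfolding u_def w_def using \<alpha> \<open>q > 0\<close> k L by (intro avg_weight_rational) (auto simp: E_def)
      then show ?thesis using True by simp
    next
      case False
      then have "\<theta> \<notin> \<rat>" using that by (auto simp: D_def E_def q_def)
      then have "avg (u \<theta>) \<longlonglongrightarrow> 0"
        unfolding u_def using \<alpha> \<open>q > 0\<close> k L by (intro avg_weight_irrational)
      then show ?thesis using False by simp
    qed
    then show ?thesis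
      unfolding \<Phi>_def using u_bound by (intro tendsto_avg_Suc)
  qed
  have int\<Phi>: "integrable \<mu> (\<Phi> n)" for n
    by (rule integrable_const_bound [where B = C]) (use \<Phi>_bound in auto)
  \<comment> \<open>Termwise: the coefficient is 0, or the weight is nonpositive and the coefficient
    has nonnegative real part.\<close>
  have Re\<Phi>: "Re (\<integral>\<theta>. \<Phi> n \<theta> \<partial>\<mu>) \<le> 0" for n
  proof -
    have "(\<integral>\<theta>. \<Phi> n \<theta> \<partial>\<mu>) = (\<Sum>s<n. of_real (weight \<alpha> L (q * Suc s)) * (\<integral>\<theta>. ee (real ((q * Suc s) ^ k) * \<theta>) \<partial>\<mu>)) / of_nat n"
      unfolding \<Phi>_def u_def avg_def
      using integrable_ee [OF \<mu>]
      by (simp add: Bochner_Integration.integral_sum mult.commute [of _ "_ ^ k"] del: of_nat_Suc of_nat_mult mult_Suc_right)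
    moreover have "Re (of_real (weight \<alpha> L (q * Suc s)) * (\<integral>\<theta>. ee (real ((q * Suc s) ^ k) * \<theta>) \<partial>\<mu>)) \<le> 0" for s
      using neg [of "q * Suc s"] nonneg [of "(q * Suc s) ^ k"] \<open>q > 0\<close>
      by (auto simp: mult_nonpos_nonneg simp del: of_nat_Suc of_nat_mult mult_Suc_right of_nat_power)
    ultimately show ?thesis
      by (auto simp: Re_divide_of_nat intro!: divide_nonpos_nonneg sum_nonpos simp del: of_nat_Suc of_nat_mult mult_Suc_right of_nat_power)
  qed
  \<comment> \<open>Cutting out \<open>D j\<close> makes the averages converge everywhere: on
    \<open>D j\<close> they become 0, in agreement with the indicator of \<open>E\<close>, which is
    disjoint from \<open>D j\<close>.\<close>
  define \<Psi> where "\<Psi> n \<theta> = indicator (- D j) \<theta> *\<^sub>R \<Phi> n \<theta>" for n \<theta>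
  have "(\<lambda>n. \<integral>\<theta>. \<Psi> n \<theta> \<partial>\<mu>) \<longlonglongrightarrow> (\<integral>\<theta>. complex_of_real (w * indicator E \<theta>) \<partial>\<mu>)"
  proof (rule integral_dominated_convergence [where w = "\<lambda>_. C"])
    have "(\<lambda>n. \<Psi> n \<theta>) \<longlonglongrightarrow> complex_of_real (w * indicator E \<theta>)" for \<theta>
    proof (cases "\<theta> \<in> D j")
      case True
      then have "\<theta> \<notin> E" by (simp add: D_def E_def q_def)
      then show ?thesis using True by (simp add: \<Psi>_def)
    qed (use lim in \<open>simp add: \<Psi>_def\<close>)
    then show "AE \<theta> in \<mu>. (\<lambda>n. \<Psi> n \<theta>) \<longlonglongrightarrow> complex_of_real (w * indicator E \<theta>)" by simp
    show "AE \<theta> in \<mu>. norm (\<Psi> n \<theta>) \<le> C" for n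
      using \<Phi>_bound \<open>C > 0\<close> by (auto simp: \<Psi>_def indicator_def)
  qed (auto simp: \<Psi>_def)
  then have "(\<lambda>n. Re (\<integral>\<theta>. \<Psi> n \<theta> \<partial>\<mu>)) \<longlonglongrightarrow> Re (\<integral>\<theta>. complex_of_real (w * indicator E \<theta>) \<partial>\<mu>)"
    by (rule tendsto_Re)
  then have "(\<lambda>n. Re (\<integral>\<theta>. \<Psi> n \<theta> \<partial>\<mu>)) \<longlonglongrightarrow> w * measure \<mu> E"
    by (simp del: of_real_mult)
  moreover have "Re (\<integral>\<theta>. \<Psi> n \<theta> \<partial>\<mu>) \<le> C * measure \<mu> (D j)" for n
  proof -
    have intD: "integrable \<mu> (\<lambda>\<theta>. indicator (D j) \<theta> *\<^sub>R \<Phi> n \<theta>)"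
      by (rule integrable_const_bound [where B = C]) (use \<Phi>_bound \<open>C > 0\<close> in \<open>auto simp: indicator_def\<close>)
    have "\<Psi> n = (\<lambda>\<theta>. \<Phi> n \<theta> - indicator (D j) \<theta> *\<^sub>R \<Phi> n \<theta>)"
      by (auto simp: \<Psi>_def indicator_def)
    then have "(\<integral>\<theta>. \<Psi> n \<theta> \<partial>\<mu>) = (\<integral>\<theta>. \<Phi> n \<theta> \<partial>\<mu>) - (\<integral>\<theta>. indicator (D j) \<theta> *\<^sub>R \<Phi> n \<theta> \<partial>\<mu>)"
      using int\<Phi> intD by simp
    moreover have "norm (\<integral>\<theta>. indicator (D j) \<theta> *\<^sub>R \<Phi> n \<theta> \<partial>\<mu>) \<le> (\<integral>\<theta>. C * indicator (D j) \<theta> \<partial>\<mu>)"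
    proof (rule Bochner_Integration.integral_norm_bound_integral [OF intD])
      show "integrable \<mu> (\<lambda>\<theta>. C * indicator (D j) \<theta>)"
        by (rule integrable_const_bound [where B = C]) (use \<open>C > 0\<close> in \<open>auto split: split_indicator\<close>)
    qed (use \<Phi>_bound in \<open>auto split: split_indicator\<close>)
    ultimately show ?thesis
      using Re\<Phi> [of n] abs_Re_le_cmod [of "\<integral>\<theta>. indicator (D j) \<theta> *\<^sub>R \<Phi> n \<theta> \<partial>\<mu>"] by simp
  qed
  ultimately have "w * measure \<mu> E \<le> C * measure \<mu> (D j)"
    by (intro LIMSEQ_le_const2) auto
  moreover have "measure \<mu> \<int> / 2 \<le> w * measure \<mu> E"
  proof -
    have "\<int> \<subseteq> E" by (auto simp: E_def)
    then have "measure \<mu> \<int> \<le> measure \<mu> E"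
      by (intro finite_measure_mono) auto
    then have "1 / 2 * measure \<mu> \<int> \<le> w * measure \<mu> E"
      using \<open>w \<ge> 1 / 2\<close> by (intro mult_mono) auto
    then show ?thesis by simp
  qed
  ultimately show False using j by linarith
qed


section \<open>Recurrence and its failure\<close>

text \<open>Supplies windows beyond any \<open>T\<close>, so that their lengths can be made to grow,
  as the lower bound for the mass of \<open>\<int>\<close> requires.\<close>

lemma frequently_dense:
  assumes "upper_density \<Lambda> > ereal \<delta>"
  shows "\<exists>N\<ge>T. real (card (\<Lambda> \<inter> {- int N..int N})) > \<delta> * (2 * real N + 1)"
proof (rule ccontr)
  assume "\<not> ?thesis"
  then have "ereal (real (card (\<Lambda> \<inter> {- int N..int N})) / (2 * real N + 1)) \<le> ereal \<delta>" if "N \<ge> T" for N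
    using that by (auto simp: not_less divide_le_eq)
  then have "upper_density \<Lambda> \<le> ereal \<delta>"
    unfolding upper_density_def
    by (intro Limsup_bounded) (auto simp: eventually_sequentially)
  then show False using assms by simp
qed

text \<open>Compactness makes \<open>T\<close> independent of \<open>\<Lambda>\<close>. If every
  \<open>T\<close> had a counterexample, a weak limit of their spectral measures would have mass at
  least \<open>\<delta>\<close> on the integers, and the \<open>r\<close> this provides is a
  forbidden return in all but finitely many members of the subsequence.\<close>

lemma finite_restricted_recurrence:
  fixes k :: nat
  assumes \<alpha>: "\<alpha> \<notin> \<rat>" and k: "k > 0" and L: "finite L" "0 \<notin> L" "k \<notin> L" and "\<delta> > 0"
  shows "\<exists>T. \<forall>\<Lambda>. upper_density \<Lambda> > ereal \<delta> \<longrightarrow>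
    (\<exists>r\<in>{1..T}. (\<forall>l\<in>L. fejer (2 ^ (l + 3)) (\<alpha> * real r ^ l) < 1) \<and>
      (\<exists>x\<in>\<Lambda>. \<exists>y\<in>\<Lambda>. x - y = int r ^ k))"
proof (rule ccontr)
  assume "\<not> ?thesis"
  then have "\<forall>T. \<exists>\<Lambda>. upper_density \<Lambda> > ereal \<delta> \<and>
      (\<forall>r\<in>{1..T}. (\<forall>l\<in>L. fejer (2 ^ (l + 3)) (\<alpha> * real r ^ l) < 1) \<longrightarrow>
        (\<forall>x\<in>\<Lambda>. \<forall>y\<in>\<Lambda>. x - y \<noteq> int r ^ k))"
    by meson
  then obtain \<Lambda> where dense: "\<And>T :: nat. upper_density (\<Lambda> T) > ereal \<delta>"
    and avoid: "\<And>T r x y. r \<in> {1..T} \<Longrightarrow> \<forall>l\<in>L. fejer (2 ^ (l + 3)) (\<alpha> * real r ^ l) < 1 \<Longrightarrow>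
      x \<in> \<Lambda> T \<Longrightarrow> y \<in> \<Lambda> T \<Longrightarrow> x - y \<noteq> int r ^ k"
    by metis
  have "\<forall>T. \<exists>N\<ge>T. real (card (\<Lambda> T \<inter> {- int N..int N})) > \<delta> * (2 * real N + 1)"
    using frequently_dense [OF dense] by blast
  then obtain N where N: "\<And>T. T \<le> N T"
    and card: "\<And>T. real (card (\<Lambda> T \<inter> {- int (N T)..int (N T)})) > \<delta> * (2 * real (N T) + 1)"
    by metis
  define B where "B T = \<Lambda> T \<inter> {- int (N T)..int (N T)}" for T
  have card': "\<delta> * (2 * real (N T) + 1) < real (card (B T))" for T
    using card [of T] by (simp add: B_def)
  have fin: "finite (B T)" for T by (simp add: B_def)
  have ne: "B T \<noteq> {}" for T
  proof
    assume "B T = {}"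
    moreover have "0 < \<delta> * (2 * real (N T) + 1)" using \<open>\<delta> > 0\<close> by (intro mult_pos_pos) auto
    ultimately show False using card' [of T] by simp
  qed
  obtain \<sigma> \<mu> where \<sigma>: "strict_mono (\<sigma> :: nat \<Rightarrow> nat)" and \<mu>: "real_distribution \<mu>"
    and conv: "\<And>h. (\<lambda>t. complex_of_real (corr (B (\<sigma> t)) h)) \<longlonglongrightarrow> (\<integral>\<theta>. ee (real_of_int h * \<theta>) \<partial>\<mu>)"
    using spectral_limit [of B] fin ne by blast
  have "\<delta> \<le> measure \<mu> \<int>"
  proof (rule measure_Ints_ge [OF \<mu> conv, where N = "\<lambda>t. N (\<sigma> t)"])
    show "t \<le> N (\<sigma> t)" for t
      using N [of "\<sigma> t"] strict_mono_imp_increasing [OF \<sigma>, of t] by linarith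
    show "\<delta> * (2 * real (N (\<sigma> t)) + 1) \<le> real (card (B (\<sigma> t)))" for t
      using card' by (intro less_imp_le)
  qed (use ne \<open>\<delta> > 0\<close> in \<open>auto simp: B_def\<close>)
  then have atom: "measure \<mu> \<int> > 0" using \<open>\<delta> > 0\<close> by simp
  have nonneg: "0 \<le> Re (\<integral>\<theta>. ee (real h * \<theta>) \<partial>\<mu>)" for h :: nat
  proof (rule LIMSEQ_le_const [OF tendsto_Re [OF conv [of "int h", simplified]]])
    show "\<exists>N. \<forall>n\<ge>N. 0 \<le> Re (complex_of_real (corr (B (\<sigma> n)) (int h)))"
      by (simp add: corr_nonneg)
  qed
  obtain r where r: "r > 0" "weight \<alpha> L r > 0" "(\<integral>\<theta>. ee (real (r ^ k) * \<theta>) \<partial>\<mu>) \<noteq> 0"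
    using spectral_positivity [OF \<mu> atom nonneg \<alpha> k L] by blast
  \<comment> \<open>For \<open>t \<ge> r\<close> also \<open>\<sigma> t \<ge> t \<ge> r\<close>, so
    \<open>r\<close> lies in the range in which \<open>\<Lambda> (\<sigma> t)\<close> admits no
    return.\<close>
  have "corr (B (\<sigma> t)) (int (r ^ k)) = 0" if "t \<ge> r" for t
  proof -
    have "r \<in> {1..\<sigma> t}"
      using that r(1) strict_mono_imp_increasing [OF \<sigma>, of t] by simp
    moreover have "\<forall>l\<in>L. fejer (2 ^ (l + 3)) (\<alpha> * real r ^ l) < 1"
      using weight_pos_imp [OF L(1) _ r(2)] by blast
    ultimately have "x + int (r ^ k) \<notin> B (\<sigma> t)" if "x \<in> B (\<sigma> t)" for x
      using avoid [of r "\<sigma> t" "x + int (r ^ k)" x] that by (auto simp: B_def)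
    then have "{x \<in> B (\<sigma> t). x + int (r ^ k) \<in> B (\<sigma> t)} = {}" by blast
    then show ?thesis by (simp only: corr_def card.empty of_nat_0 div_0)
  qed
  then have "\<forall>\<^sub>F t in sequentially. complex_of_real (corr (B (\<sigma> t)) (int (r ^ k))) = 0"
    unfolding eventually_sequentially by (intro exI [of _ r]) (simp del: of_nat_power)
  then have "(\<lambda>t. complex_of_real (corr (B (\<sigma> t)) (int (r ^ k)))) \<longlonglongrightarrow> 0"
    by (rule tendsto_eventually)
  then have "(\<integral>\<theta>. ee (real_of_int (int (r ^ k)) * \<theta>) \<partial>\<mu>) = 0"
    using conv LIMSEQ_unique by blast
  then show False using r(3) by simp
qed

section \<open>Colourings and the failure of intersectivity\<close>

lemma finite_colouring_dense:
  fixes f :: "int \<Rightarrow> 'c"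
  assumes "finite (range f)"
  shows "\<exists>c. upper_density {x. f x = c} > 0"
proof (rule ccontr)
  assume "\<not> ?thesis"
  then have le: "upper_density {x. f x = c} \<le> 0" for c by (simp add: not_less)
  define \<rho> where "\<rho> c N = real (card ({x. f x = c} \<inter> {- int N..int N})) / (2 * real N + 1)" for c N
  have "\<rho> c \<longlonglongrightarrow> 0" for c
  proof (rule order_tendstoI)
    fix a :: real
    assume "a < 0"
    moreover have "\<rho> c N \<ge> 0" for N by (simp add: \<rho>_def)
    ultimately show "\<forall>\<^sub>F N in sequentially. a < \<rho> c N"
      by (intro always_eventually allI) (rule less_le_trans)
  next
    fix a :: real
    assume "0 < a"
    then have "limsup (\<lambda>N. ereal (\<rho> c N)) < ereal a"
      using le [of c] by (auto simp: upper_density_def \<rho>_def intro: le_less_trans)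
    then show "\<forall>\<^sub>F N in sequentially. \<rho> c N < a"
      by (auto dest: Limsup_lessD)
  qed
  \<comment> \<open>The classes partition each window, so their finitely many relative densities add
    up to 1, although each of them tends to 0.\<close>
  then have "(\<lambda>N. \<Sum>c\<in>range f. \<rho> c N) \<longlonglongrightarrow> (\<Sum>c\<in>range f. 0)"
    by (intro tendsto_sum)
  moreover have "(\<Sum>c\<in>range f. \<rho> c N) = 1" for N
  proof -
    have "(\<Sum>c\<in>range f. card ({x. f x = c} \<inter> {- int N..int N}))
        = card (\<Union>c\<in>range f. {x. f x = c} \<inter> {- int N..int N})"
      using assms by (intro card_UN_disjoint [symmetric]) auto
    also have "(\<Union>c\<in>range f. {x. f x = c} \<inter> {- int N..int N}) = {- int N..int N}" by auto
    finally have "(\<Sum>c\<in>range f. real (card ({x. f x = c} \<inter> {- int N..int N}))) = 2 * real N + 1"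
      by (simp flip: of_nat_sum)
    then show ?thesis
      unfolding \<rho>_def by (simp flip: sum_divide_distrib)
  qed
  ultimately show False
    by (simp add: LIMSEQ_const_iff)
qed

text \<open>Colour \<open>x\<close> by its residue modulo \<open>m\<close> and by a small ball
  containing \<open>ee (\<alpha> * x)\<close>. If two points of one colour differ by an element
  \<open>s\<close> of \<open>S\<close>, then \<open>s\<close> is one of the finitely many
  exceptional elements and divisible by \<open>m\<close>; as \<open>m\<close> exceeds all their
  absolute values, \<open>s = 0\<close>.\<close>

lemma not_intersectiveI:
  assumes fin: "finite {s \<in> S. norm (ee (\<alpha> * real_of_int s) - 1) < \<epsilon>}" and "\<epsilon> > 0"
  shows "\<not> intersective S"
proof
  assume int: "intersective S"
  define F where "F = {s \<in> S. norm (ee (\<alpha> * real_of_int s) - 1) < \<epsilon>}"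
  \<comment> \<open>The summand 1 makes \<open>m\<close> positive, also for empty \<open>F\<close>,
    and strictly larger than every \<open>\<bar>s\<bar>\<close>.\<close>
  define m where "m = 1 + (\<Sum>s\<in>F. \<bar>s\<bar>)"
  have m: "\<bar>s\<bar> < m" if "s \<in> F" for s
    using member_le_sum [of s F abs] that fin by (simp add: m_def F_def)
  have "m > 0" unfolding m_def by (simp add: sum_nonneg add_pos_nonneg)
  obtain K :: "complex set" where K: "finite K" "sphere 0 1 \<subseteq> (\<Union>z\<in>K. ball z (\<epsilon> / 2))"
    using compact_sphere [of "0 :: complex" 1] \<open>\<epsilon> > 0\<close>
    unfolding compact_eq_totally_bounded by (meson half_gt_zero)
  have "\<forall>x. \<exists>z\<in>K. dist z (ee (\<alpha> * real_of_int x)) < \<epsilon> / 2"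
    using K(2) by (force simp: subset_iff)
  then obtain g where g: "\<And>x. g x \<in> K" "\<And>x :: int. dist (g x) (ee (\<alpha> * real_of_int x)) < \<epsilon> / 2"
    by metis
  define f where "f x = (x mod m, g x)" for x
  have "range f \<subseteq> {0..<m} \<times> K"
    using g(1) \<open>m > 0\<close> by (auto simp: f_def)
  then have "finite (range f)"
    by (rule finite_subset) (use K(1) in simp)
  from finite_colouring_dense [OF this]
  obtain c where "upper_density {x. f x = c} > 0" by blast
  then have "\<exists>x\<in>{x. f x = c}. \<exists>y\<in>{x. f x = c}. \<exists>s\<in>S - {0}. x - y = s"
    using int unfolding intersective_def by (elim allE impE)
  then obtain x y s where "x \<in> {x. f x = c}" "y \<in> {x. f x = c}" "s \<in> S - {0}" and "x - y = s"
    by (elim bexE)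
  then have xy: "x mod m = y mod m" "g x = g y" and s: "s \<in> S" "s \<noteq> 0" "x - y = s"
    by (auto simp: f_def)
  \<comment> \<open>Multiplying by a unimodular factor turns the distance from 1 into the distance
    between the phases at \<open>x\<close> and \<open>y\<close>, which share a ball of radius
    \<open>\<epsilon> / 2\<close>.\<close>
  have "norm (ee (\<alpha> * real_of_int s) - 1) = norm (ee (\<alpha> * real_of_int y) * (ee (\<alpha> * real_of_int s) - 1))"
    by (simp add: norm_mult)
  also have "ee (\<alpha> * real_of_int y) * (ee (\<alpha> * real_of_int s) - 1) = ee (\<alpha> * real_of_int x) - ee (\<alpha> * real_of_int y)"
    using s(3) [symmetric]
    by (simp add: right_diff_distrib ee_add [symmetric] distrib_left [symmetric] flip: of_int_add)
  also have "norm \<dots> < \<epsilon>"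
    using g(2) [of x] g(2) [of y] xy norm_diff_triangle_less [of "ee (\<alpha> * real_of_int x)" "g x" "\<epsilon> / 2" "ee (\<alpha> * real_of_int y)" "\<epsilon> / 2"]
    by (simp add: dist_norm norm_minus_commute)
  finally have "s \<in> F" using s(1) by (simp add: F_def)
  then have "\<bar>s\<bar> < m" by (rule m)
  moreover have "m dvd s"
    using xy(1) s(3) by (metis mod_eq_dvd_iff)
  ultimately show False
    using s(2) dvd_imp_le_int [of s m] \<open>m > 0\<close> by simp
qed

section \<open>Assembling the set from finite stages\<close>

theorem theoremA:
  fixes G :: "nat set"
  assumes "\<forall>g\<in>G. g > 0"
  shows "\<exists>R :: int set. \<forall>k::nat. k > 0 \<longrightarrow> (intersective ((\<lambda>r. r ^ k) ` R) \<longleftrightarrow> k \<in> G)"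
proof -
  obtain \<alpha> :: real where \<alpha>: "\<alpha> \<notin> \<rat>"
    using countable_rat uncountable_UNIV_real by (metis UNIV_eq_I)
  \<comment> \<open>Stage \<open>n\<close> restricts only the finitely many exponents
    \<open>l \<le> n\<close> outside \<open>G\<close>; each such \<open>l\<close> is thus restricted
    at all but finitely many stages.\<close>
  define good where "good n r \<longleftrightarrow> (\<forall>l\<in>{1..n} - G. fejer (2 ^ (l + 3)) (\<alpha> * real r ^ l) < 1)" for n r :: nat
  define covers where "covers n k T \<longleftrightarrow> (\<forall>\<Lambda>. upper_density \<Lambda> > ereal (1 / real (Suc n)) \<longrightarrow>
      (\<exists>r\<in>{1..T}. good n r \<and> (\<exists>x\<in>\<Lambda>. \<exists>y\<in>\<Lambda>. x - y = int r ^ k)))" for n k T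
  have "\<exists>T. covers n k T" if "k \<in> G" for n k
    unfolding good_def covers_def using that assms by (intro finite_restricted_recurrence \<alpha>) auto
  then have "\<forall>n k. \<exists>T. k \<in> G \<longrightarrow> covers n k T" by blast
  then obtain T where T: "\<And>n k. k \<in> G \<Longrightarrow> covers n k (T n k)"
    by metis
  \<comment> \<open>Stage \<open>n\<close> serves only \<open>k \<le> n\<close>, each with
    \<open>r \<le> T n k\<close>, so every stage is finite.\<close>
  define R where "R = int ` (\<Union>n. \<Union>k\<in>G \<inter> {..n}. {r \<in> {1..T n k}. good n r})"
  have "intersective ((\<lambda>r. r ^ k) ` R)" if "k \<in> G" for k
    unfolding intersective_def
  proof (intro allI impI)
    fix \<Lambda> :: "int set"
    assume "upper_density \<Lambda> > 0"
    then obtain e where e: "0 < ereal e" "ereal e < upper_density \<Lambda>"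
      using ereal_dense2 by blast
    obtain n0 where n0: "inverse (real (Suc n0)) < e"
      using reals_Archimedean e(1) by auto
    \<comment> \<open>\<open>n \<ge> n0\<close> meets the density threshold, and
      \<open>n \<ge> k\<close> ensures that stage \<open>n\<close> serves \<open>k\<close>.\<close>
    define n where "n = max n0 k"
    have "1 / real (Suc n) \<le> inverse (real (Suc n0))"
      by (simp add: n_def field_simps)
    then have "ereal (1 / real (Suc n)) < upper_density \<Lambda>"
      using n0 e(2) by (metis ereal_less_eq(3) less_imp_le order_trans le_less_trans)
    with T [OF that, of n] obtain r x y where r: "r \<in> {1..T n k}" "good n r"
      and xy: "x \<in> \<Lambda>" "y \<in> \<Lambda>" "x - y = int r ^ k"
      unfolding covers_def by blast
    have "int r \<in> R"
      unfolding R_def using that r by (intro imageI UN_I [of n] UN_I [of k]) (auto simp: n_def)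
    moreover have "int r ^ k \<noteq> 0" using r(1) by simp
    ultimately show "\<exists>x\<in>\<Lambda>. \<exists>y\<in>\<Lambda>. \<exists>r\<in>(\<lambda>r. r ^ k) ` R - {0}. x - y = r"
      using xy by blast
  qed
  moreover have "\<not> intersective ((\<lambda>r. r ^ l) ` R)" if "l > 0" "l \<notin> G" for l
  proof (rule not_intersectiveI)
    \<comment> \<open>The threshold of \<open>fejer_ge_1\<close> for \<open>M = 2 ^ (l + 3)\<close>:
      a phase this close to 1 violates the restriction for \<open>l\<close>.\<close>
    let ?\<epsilon> = "1 / (4 * real (2 ^ (l + 3)))"
    show "?\<epsilon> > 0" by simp
    \<comment> \<open>An element from a stage \<open>n \<ge> l\<close> obeys the restriction for
      \<open>l\<close>, so only stages \<open>n < l\<close> contribute. The finite superset forgets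
      the other conditions on \<open>r\<close> and \<open>k\<close>.\<close>
    have "{s \<in> (\<lambda>r. r ^ l) ` R. norm (ee (\<alpha> * real_of_int s) - 1) < ?\<epsilon>}
        \<subseteq> (\<lambda>r. int r ^ l) ` (\<Union>n<l. \<Union>k\<le>n. {1..T n k})"
    proof
      fix s
      assume "s \<in> {s \<in> (\<lambda>r. r ^ l) ` R. norm (ee (\<alpha> * real_of_int s) - 1) < ?\<epsilon>}"
      then obtain n k r where r: "s = int r ^ l" "k \<le> n" "r \<in> {1..T n k}" "good n r"
        and small: "norm (ee (\<alpha> * real_of_int s) - 1) < ?\<epsilon>"
        unfolding R_def by auto
      have "1 \<le> fejer (2 ^ (l + 3)) (\<alpha> * real r ^ l)"
        using small r(1) by (intro fejer_ge_1) auto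
      then have "\<not> (l \<in> {1..n} - G)"
        using r(4) unfolding good_def by (meson not_le)
      then have "n < l" using that by auto
      then show "s \<in> (\<lambda>r. int r ^ l) ` (\<Union>n<l. \<Union>k\<le>n. {1..T n k})"
        using r by blast
    qed
    then show "finite {s \<in> (\<lambda>r. r ^ l) ` R. norm (ee (\<alpha> * real_of_int s) - 1) < ?\<epsilon>}"
      by (rule finite_subset) simp
  qed
  ultimately show ?thesis by blast
qed

end
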